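(* Let $M\ge 1$, let $f_1,\dots,f_M$ be location-scale families of densities on $\mathbb{R}$, let $f(x;\theta)$, $\theta\in\Theta$, be the corresponding $M$-component mixture, let $\theta_0\in\Theta$, $f_0(x)=f(x;\theta_0)$, and let $x_1,x_2,\dots$ be i.i.d. with density $f(x;\theta_0)$. Assume: (i) there are real constants $v_0,v_1>0$ and $\beta>1$ such that $f_m(x;\mu_m=0,\sigma_m=1)\le\min\{v_0,\,v_1|x|^{-\beta}\}$ for all $x$ and all $m$; (ii) for every compact $\Gamma\subset\Theta$, each $\theta\in\Gamma$ and all sufficiently small $\rho>0$, the function $x\mapsto f(x;\theta,\rho)=\sup_{\operatorname{dist}(\theta',\theta)\le\rho}f(x;\theta')$ is measurable; (iii) for every compact $\Gamma\subset\Theta$ and each $\theta\in\Gamma$, if $\theta^{(j)}\in\Gamma$ and $\lim_{j\to\infty}\theta^{(j)}=\theta$, then $\lim_{j\to\infty}f(x;\theta^{(j)})=f(x;\theta)$ except on a null set of $x$ which does not depend on the sequence $\{\theta^{(j)}\}$; (iv) $\int|\log f(x;\theta_0)|\,f(x;\theta_0)\,dx<\infty$. Suppose moreover that $f_0\in\mathscr{G}_M\setminus\mathscr{G}_{M-1}$. Let $c_0>0$ and $0<d<1$, let $c_n=c_0\exp(-n^d)$ and $$\Theta_n=\{\theta\in\Theta\mid\sigma_m\ge c_n,\ m=1,\dots,M\},$$ and let $\hat\theta_n$ be the maximum likelihood estimator restricted to $\Theta_n$ based on $x_1,\dots,x_n$. Then $$\mathrm{Prob}\left(\lim_{n\to\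infty}\operatorname{dist}(\Theta(\hat\theta_n),\Theta_0)=0\right)=1.$$
   Context: For $m=1,\dots,M$, $f_m(x;\mu_m,\sigma_m)=\frac1{\sigma_m}f_m\left(\frac{x-\mu_m}{\sigma_m};0,1\right)$ is a location-scale family of probability densities on $\mathbb{R}$ with $\mu_m\in\mathbb{R}$, $\sigma_m>0$ (different $m$ may use different families). The parameter is $\theta=(\alpha_1,\mu_1,\sigma_1,\dots,\alpha_M,\mu_M,\sigma_M)$; $\Theta$ is the set of such $\theta$ with $\alpha_m\ge0$, $\sum_{m=1}^M\alpha_m=1$, $\mu_m\in\mathbb{R}$, $\sigma_m\in(0,\infty)$. The mixture density is $f(x;\theta)=\sum_{m=1}^M\alpha_m f_m(x;\mu_m,\sigma_m)$. For $\mathscr{K}\subset\{1,\dots,M\}$, $\theta_{\mathscr{K}}$ is the subvector of $\theta$ consisting of the components in $\mathscr{K}$; $\bar\Theta_{\mathscr{K}}=\{\theta_{\mathscr{K}}\mid\theta\in\Theta,\ \sum_{m\in\mathscr{K}}\alpha_m\le1\}$; $f_{\mathscr{K}}(x;\theta_{\mathscr{K}})=\sum_{k\in\mathscr{K}}\alpha_kf_k(x;\mu_k,\sigma_k)$; $\mathscr{G}_{\mathscr{K}}=\{f_{\mathscr{K}}(\cdot;\theta_{\mathscr{K}})\mid\theta_{\mathscr{K}}\in\bar\Theta_{\mathscr{K}}\}$; and $\mathscr{G}_K=\bigcup_{|\mathscr{K}|\le K}\mathscr{G}_{\mathscr{K}}$ is the set of subprobability densities with no more than $K$ components. $\operatorname{dist}(\theta,\theta')$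 is Euclidean distance between parameter vectors; for $U,V\subset\Theta$, $\operatorname{dist}(U,V)=\inf_{\theta\in U}\inf_{\theta'\in V}\operatorname{dist}(\theta,\theta')$. For $\theta\in\Theta$, $\Theta(\theta)=\{\theta'\in\Theta\mid f(x;\theta')=f(x;\theta)\ \forall x\}$, and $\Theta_0=\Theta(\theta_0)$. The maximum likelihood estimator restricted to $\Theta_n$ is a maximizer $\hat\theta_n$ of $\prod_{i=1}^nf(x_i;\theta)$ over $\theta\in\Theta_n$.
   Formalization: In Θ(θ), and so in Θ₀, equality of f(x;θ') and f(x;θ) is required for almost every x instead of for all x; with equality at every x the claim fails, e.g. for two closed uniform components that touch at one point. For continuous component densities the two agree. *)

theory Defs
  imports "HOL-Probability.Probability"
begin

text \<open>The component index ranges over a finite type \<open>'m\<close>, so the number of components is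
  \<open>M = CARD('m) \<ge> 1\<close>. A parameter vector lists a triple (weight, location, scale) for each
  component; \<^term>\<open>dist\<close> on this type is the Euclidean distance of \<open>3 * M\<close> real coordinates.\<close>

type_synonym component = "real \<times> real \<times> real"

type_synonym 'm param = "component ^ 'm"

abbreviation weight :: "component \<Rightarrow> real" where "weight t \<equiv> fst t"
abbreviation location :: "component \<Rightarrow> real" where "location t \<equiv> fst (snd t)"
abbreviation scale :: "component \<Rightarrow> real" where "scale t \<equiv> snd (snd t)"

definition prob_density :: "(real \<Rightarrow> real) \<Rightarrow> bool" where
  "prob_density g \<longleftrightarrow>
     g \<in> borel_measurable borel \<and> (\<forall>x. 0 \<le> g x) \<and> (\<integral>\<^sup>+ x. ennreal (g x) \<partial>lborel) = 1"

definition loc_scale :: "(real \<Rightarrow> real) \<Rightarrow> real \<Rightarrow> real \<Rightarrow> real \<Rightarrow> real" where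
  "loc_scale g \<mu> \<sigma> x = g ((x - \<mu>) / \<sigma>) / \<sigma>"

definition Params :: "'m::finite param set" where
  "Params = {\<theta>. (\<forall>m. 0 \<le> weight (\<theta> $ m) \<and> 0 < scale (\<theta> $ m)) \<and> (\<Sum>m\<in>UNIV. weight (\<theta> $ m)) = 1}"

text \<open>Throughout, \<open>\<phi> m\<close> is the density of the \<open>m\<close>-th family at location 0 and scale 1.\<close>

definition mixture :: "('m::finite \<Rightarrow> real \<Rightarrow> real) \<Rightarrow> 'm param \<Rightarrow> real \<Rightarrow> real" where
  "mixture \<phi> \<theta> x =
     (\<Sum>m\<in>UNIV. weight (\<theta> $ m) * loc_scale (\<phi> m) (location (\<theta> $ m)) (scale (\<theta> $ m)) x)"

text \<open>The subvector of \<open>\<theta>\<close> with components in \<open>S\<close> is the extensional function on \<open>S\<close>.\<close>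

definition subvector :: "'m set \<Rightarrow> 'm::finite param \<Rightarrow> 'm \<Rightarrow> component" where
  "subvector S \<theta> = restrict (\<lambda>m. \<theta> $ m) S"

definition sub_params :: "'m::finite set \<Rightarrow> ('m \<Rightarrow> component) set" where
  "sub_params S = {subvector S \<theta> |\<theta>. \<theta> \<in> Params \<and> (\<Sum>m\<in>S. weight (\<theta> $ m)) \<le> 1}"

definition submixture ::
    "('m::finite \<Rightarrow> real \<Rightarrow> real) \<Rightarrow> 'm set \<Rightarrow> ('m \<Rightarrow> component) \<Rightarrow> real \<Rightarrow> real" where
  "submixture \<phi> S \<tau> x = (\<Sum>k\<in>S. weight (\<tau> k) * loc_scale (\<phi> k) (location (\<tau> k)) (scale (\<tau> k)) x)"

definition subdensities_on :: "('m::finite \<Rightarrow> real \<Rightarrow> real) \<Rightarrow> 'm set \<Rightarrow> (real \<Rightarrow> real) set" where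
  "subdensities_on \<phi> S = {submixture \<phi> S \<tau> |\<tau>. \<tau> \<in> sub_params S}"

definition subdensities :: "('m::finite \<Rightarrow> real \<Rightarrow> real) \<Rightarrow> nat \<Rightarrow> (real \<Rightarrow> real) set" where
  "subdensities \<phi> K = (\<Union>S\<in>{S. card S \<le> K}. subdensities_on \<phi> S)"

text \<open>Two parameters are equivalent if they have the same mixture density. As usual, densities
  are identified when they agree up to a Lebesgue null set; if the component densities are
  continuous this is equality at every point, see \<open>equiv_params_continuous\<close> below. For
  discontinuous components the distinction matters: let \<open>M = 2\<close> with both components uniform on
  \<open>[0, 1]\<close>, and let the true density be the mixture with weights 1/2 of the uniform densities on
  \<open>[0, 1]\<close> and \<open>[1, 2]\<close>. It differs from the uniform density on \<open>[0, 2]\<close> only at the point 1,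
  which no sample ever hits, so an estimator cannot tell them apart.\<close>

definition equiv_params :: "('m::finite \<Rightarrow> real \<Rightarrow> real) \<Rightarrow> 'm param \<Rightarrow> 'm param set" where
  "equiv_params \<phi> \<theta> = {\<theta>' \<in> Params. AE x in lborel. mixture \<phi> \<theta>' x = mixture \<phi> \<theta> x}"

lemma equiv_params_continuous:
  assumes "\<And>m. continuous_on UNIV (\<phi> m)" and "\<theta> \<in> Params"
  shows "equiv_params \<phi> \<theta> = {\<theta>' \<in> Params. \<forall>x. mixture \<phi> \<theta>' x = mixture \<phi> \<theta> x}"
proof -
  have cont: "continuous_on UNIV (mixture \<phi> \<eta>)" if "\<eta> \<in> Params" for \<eta>
  proof -
    have "scale (\<eta> $ m) \<noteq> 0" for m
      using that by (auto simp: Params_def less_le)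
    then have "continuous_on UNIV (\<lambda>x. weight (\<eta> $ m) *
        (\<phi> m ((x - location (\<eta> $ m)) / scale (\<eta> $ m)) / scale (\<eta> $ m)))" for m
      by (intro continuous_intros continuous_on_compose2[OF assms(1)]) auto
    then show ?thesis
      unfolding mixture_def loc_scale_def by (intro continuous_on_sum) auto
  qed
  have "mixture \<phi> \<theta>' x = mixture \<phi> \<theta> x"
    if "\<theta>' \<in> Params" and ae: "AE x in lborel. mixture \<phi> \<theta>' x = mixture \<phi> \<theta> x" for \<theta>' x
  proof -
    let ?C = "{x. mixture \<phi> \<theta>' x = mixture \<phi> \<theta> x}"
    have "closed ?C"
      using cont[OF that(1)] cont[OF assms(2)] by (intro closed_Collect_eq) auto
    moreover have "AE x in lebesgue. x \<in> ?C"
      using AE_completion[OF ae] by simp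
    ultimately show ?thesis
      using mem_closed_if_AE_lebesgue by blast
  qed
  then show ?thesis
    by (auto simp: equiv_params_def)
qed

definition restricted_params :: "real \<Rightarrow> 'm::finite param set" where
  "restricted_params c = {\<theta> \<in> Params. \<forall>m. c \<le> scale (\<theta> $ m)}"

text \<open>The sample of size \<open>n\<close> consists of \<open>x 1, \<dots>, x n\<close>.\<close>

definition is_restricted_mle ::
    "('m::finite \<Rightarrow> real \<Rightarrow> real) \<Rightarrow> real \<Rightarrow> nat \<Rightarrow> (nat \<Rightarrow> real) \<Rightarrow> 'm param \<Rightarrow> bool" where
  "is_restricted_mle \<phi> c n x \<theta> \<longleftrightarrow>
     is_arg_max (\<lambda>\<eta>. \<Prod>i=1..n. mixture \<phi> \<eta> (x i)) (\<lambda>\<eta>. \<eta> \<in> restricted_params c) \<theta>"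

end

theory Submission
  imports Defs "HOL-Real_Asymp.Real_Asymp"
begin

text \<open>As soon as the sieve contains the true parameter, the restricted estimator has at least its
likelihood. So it suffices that almost surely, for all large sample sizes, every parameter of the
sieve that stays away from the parameters of the true density \<open>f\<^sub>0\<close> has a strictly smaller
likelihood than the true one.

Likelihood ratios are controlled by Chernoff bounds. For \<open>0 < t < 1\<close> the expectation of
\<open>\<Prod>i. (H (X i) / f\<^sub>0 (X i)) powr t\<close> is at most the \<open>n\<close>-th power of the affinity
\<open>\<integral> H powr t * f\<^sub>0 powr (1 - t)\<close>, so if the affinity is below 1, the ratio decays exponentially, almost
surely (\<open>likelihood_ratio_decay\<close>). The tail bound gives \<open>f\<^sub>0 x = O((1 + \<bar>x\<bar>) powr -\<beta>)\<close>, hence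
\<open>f\<^sub>0 powr (1 - t)\<close> is integrable for \<open>t < 1 - 1 / \<beta>\<close>. For such \<open>t\<close> the affinity is finite for every
bounded \<open>H\<close> and continuous under bounded almost everywhere convergence, although \<open>H\<close> itself need not
be integrable (\<open>affinity_tendsto\<close>). By Young's inequality it is below 1 when \<open>H\<close> is a density other
than \<open>f\<^sub>0\<close> (\<open>affinity_less_one\<close>), so it remains below 1 for a slightly larger envelope \<open>H\<close>.

The parameter set is not compact: scales may tend to 0 or to infinity, and locations to infinity.
The map \<open>flatten S R\<close> keeps all weights and moves the components outside \<open>S\<close> to location 0 and scale
\<open>R\<close>; flattened parameters stay in a compact region if the components in \<open>S\<close> do. The components that
were moved are dominated separately. A diffuse one is uniformly small on a large interval and bounded
elsewhere, which costs little in the affinity. A narrow one with scale \<open>\<sigma>\<close> is small outside an interval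
of radius \<open>\<sigma> powr \<gamma>\<close> and at most \<open>v\<^sub>0 / \<sigma>\<close> inside, so it raises the log-likelihood by at most the number
of observations in this interval times \<open>ln (1 + v\<^sub>0 / (\<kappa> * \<sigma>))\<close>. Almost surely an interval of radius \<open>r\<close>
contains at most \<open>C * (n * r + 1 + ln n)\<close> observations, simultaneously for all intervals
(\<open>interval_counts\<close>). The part \<open>n * \<sigma> powr \<gamma> * ln (1 / \<sigma>)\<close> is a small multiple of \<open>n\<close> for small \<open>\<sigma>\<close>, and
the part \<open>ln n * ln (1 / \<sigma>)\<close> is at most of order \<open>ln n * n powr d = o(n)\<close> on the sieve; this is where
\<open>d < 1\<close> is needed (\<open>narrow_peaks_negligible\<close>). Together these bounds show that near a parameter of a
wrong density nothing in the sieve can win, whatever the escaping components do (\<open>local_domination\<close>).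

Finally, along a subsequence on which the estimates keep their distance from the true parameters,
each component either converges or leaves every compact set. Let \<open>S\<close> collect the convergent ones. If
for some \<open>R\<close> the limit of the flattened estimates has a density other than \<open>f\<^sub>0\<close>, local domination is
contradicted. Otherwise the escaping components have limit weight 0 (\<open>flat_weights_vanish\<close>), and
removing their weights changes the estimates by a vanishing amount into parameters of \<open>f\<^sub>0\<close>.\<close>

section \<open>Location-scale densities and their mixtures\<close>

lemma nn_integral_powr_lt_top:
  assumes "1 < (p::real)"
  shows "(\<integral>\<^sup>+x. ennreal ((1 + \<bar>x\<bar>) powr (-p)) \<partial>lborel) < \<infinity>"
proof -
  have half: "(\<integral>\<^sup>+x. ennreal ((1 + x) powr (-p)) * indicator {0..} x \<partial>lborel) < \<infinity>"
  proof -
    have "(\<integral>\<^sup>+x. ennreal ((1 + x) powr (-p)) * indicator {0..} x \<partial>lborel)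
        = ennreal (0 - (1 + 0) powr (1 - p) / (1 - p))"
    proof (rule nn_integral_FTC_atLeast)
      show "((\<lambda>x. (1 + x) powr (1 - p) / (1 - p)) has_real_derivative (1 + x) powr (- p)) (at x)"
        if "0 \<le> x" for x
        using that assms by (auto intro!: derivative_eq_intros)
      have "((\<lambda>x. (1 + x) powr (1 - p)) \<longlongrightarrow> 0) at_top"
        using assms
        by (intro tendsto_neg_powr filterlim_tendsto_add_at_top[OF tendsto_const] filterlim_ident) auto
      from tendsto_divide[OF this tendsto_const, of "1 - p"] assms
      show "((\<lambda>x. (1 + x) powr (1 - p) / (1 - p)) \<longlongrightarrow> 0) at_top" by simp
    qed auto
    then show ?thesis by simp
  qed
  have "(\<integral>\<^sup>+x. ennreal ((1 + \<bar>x\<bar>) powr (-p)) \<partial>lborel) \<le>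
    (\<integral>\<^sup>+x. ennreal ((1 + x) powr (-p)) * indicator {0..} x
         + ennreal ((1 + -x) powr (-p)) * indicator {0..} (-x) \<partial>lborel)"
    by (intro nn_integral_mono) (auto split: split_indicator)
  also have "\<dots> = (\<integral>\<^sup>+x. ennreal ((1 + x) powr (-p)) * indicator {0..} x \<partial>lborel)
     + (\<integral>\<^sup>+x. ennreal ((1 + -x) powr (-p)) * indicator {0..} (-x) \<partial>lborel)"
    by (rule nn_integral_add) measurable
  also have "(\<integral>\<^sup>+x. ennreal ((1 + -x) powr (-p)) * indicator {0..} (-x) \<partial>lborel)
     = (\<integral>\<^sup>+x. ennreal ((1 + x) powr (-p)) * indicator {0..} x \<partial>lborel)"
    by (subst nn_integral_real_affine[where c="-1" and t=0 and
      f="\<lambda>x. ennreal ((1 + x) powr (-p)) * indicator {0..} x"]) auto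
  finally show ?thesis
    by (rule le_less_trans) (use half in simp)
qed

locale loc_scale_families =
  fixes \<phi> :: "'m::finite \<Rightarrow> real \<Rightarrow> real" and v\<^sub>0 v\<^sub>1 \<beta> :: real
  assumes densities: "\<And>m. prob_density (\<phi> m)"
    and bounds_pos: "0 < v\<^sub>0" "0 < v\<^sub>1" "1 < \<beta>"
    and tail_bound: "\<And>m x. \<phi> m x \<le> v\<^sub>0 \<and> (x \<noteq> 0 \<longrightarrow> \<phi> m x \<le> v\<^sub>1 * \<bar>x\<bar> powr (-\<beta>))"
begin

lemma phi_measurable [measurable]: "\<phi> m \<in> borel_measurable borel"
  using densities[of m] by (simp add: prob_density_def)

lemma phi_nonneg: "0 \<le> \<phi> m x"
  using densities[of m] by (simp add: prob_density_def)

lemma loc_scale_measurable [measurable]: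
  "(\<lambda>x. loc_scale (\<phi> m) \<mu> \<sigma> x) \<in> borel_measurable borel"
  unfolding loc_scale_def by measurable

lemma loc_scale_nonneg: "0 < \<sigma> \<Longrightarrow> 0 \<le> loc_scale (\<phi> m) \<mu> \<sigma> x"
  by (simp add: loc_scale_def phi_nonneg)

lemma loc_scale_le_height: "0 < \<sigma> \<Longrightarrow> loc_scale (\<phi> m) \<mu> \<sigma> x \<le> v\<^sub>0 / \<sigma>"
  using tail_bound[of m] by (simp add: loc_scale_def divide_right_mono)

lemma loc_scale_le_tail:
  assumes "0 < \<sigma>" "x \<noteq> \<mu>"
  shows "loc_scale (\<phi> m) \<mu> \<sigma> x \<le> v\<^sub>1 * \<sigma> powr (\<beta> - 1) * \<bar>x - \<mu>\<bar> powr (-\<beta>)"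
proof -
  have "\<phi> m ((x - \<mu>) / \<sigma>) \<le> v\<^sub>1 * \<bar>(x - \<mu>) / \<sigma>\<bar> powr (-\<beta>)"
    using tail_bound[of m "(x - \<mu>) / \<sigma>"] assms by simp
  also have "\<dots> = v\<^sub>1 * \<sigma> powr \<beta> * \<bar>x - \<mu>\<bar> powr (-\<beta>)"
    using assms by (simp add: abs_div powr_divide powr_minus field_simps)
  finally show ?thesis
    using assms by (simp add: loc_scale_def powr_diff divide_simps mult_ac)
qed

text \<open>With \<open>y = (x - \<mu>) / \<sigma>\<close>, the quantity \<open>1 + \<bar>x\<bar>\<close> is at most \<open>1 + \<bar>\<mu>\<bar> + \<sigma>\<close> times \<open>1 + \<bar>y\<bar>\<close>, so
  the tail bound of the standardized density is inherited up to a constant.\<close>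

lemma loc_scale_decay:
  assumes "0 < \<sigma>"
  shows "\<exists>C. \<forall>x. loc_scale (\<phi> m) \<mu> \<sigma> x \<le> C * (1 + \<bar>x\<bar>) powr (-\<beta>)"
proof (intro exI allI)
  fix x
  define y where "y = (x - \<mu>) / \<sigma>"
  define K where "K = 1 + \<bar>\<mu>\<bar> + \<sigma>"
  have K: "K > 0" using assms by (simp add: K_def)
  have two: "\<phi> m y \<le> (v\<^sub>0 + v\<^sub>1) * 2 powr \<beta> * (1 + \<bar>y\<bar>) powr (-\<beta>)"
  proof (cases "\<bar>y\<bar> \<le> 1")
    case True
    have "(1 + \<bar>y\<bar>) powr \<beta> \<le> 2 powr \<beta>"
      using True bounds_pos by (intro powr_mono2) auto
    then have "1 \<le> 2 powr \<beta> * (1 + \<bar>y\<bar>) powr (-\<beta>)"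
      by (simp add: powr_minus field_simps)
    then have "v\<^sub>0 * 1 \<le> (v\<^sub>0 + v\<^sub>1) * (2 powr \<beta> * (1 + \<bar>y\<bar>) powr (-\<beta>))"
      using bounds_pos by (intro mult_mono) auto
    then show ?thesis using tail_bound[of m y] by (simp add: mult.assoc)
  next
    case False
    have "(1 + \<bar>y\<bar>) powr \<beta> \<le> (2 * \<bar>y\<bar>) powr \<beta>"
      using False bounds_pos by (intro powr_mono2) auto
    then have "\<bar>y\<bar> powr (-\<beta>) \<le> 2 powr \<beta> * (1 + \<bar>y\<bar>) powr (-\<beta>)"
      using False by (simp add: powr_minus powr_mult field_simps)
    then have "v\<^sub>1 * \<bar>y\<bar> powr (-\<beta>) \<le> (v\<^sub>0 + v\<^sub>1) * (2 powr \<beta> * (1 + \<bar>y\<bar>) powr (-\<beta>))"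
      using bounds_pos by (intro mult_mono) auto
    then show ?thesis using False tail_bound[of m y] by (simp add: mult.assoc) linarith
  qed
  have "x = \<mu> + \<sigma> * y" using assms by (simp add: y_def)
  then have "\<bar>x\<bar> \<le> \<bar>\<mu>\<bar> + \<bar>\<sigma> * y\<bar>" by linarith
  also have "\<bar>\<sigma> * y\<bar> = \<sigma> * \<bar>y\<bar>" using assms by (simp add: abs_mult)
  finally have "\<bar>x\<bar> \<le> \<bar>\<mu>\<bar> + \<sigma> * \<bar>y\<bar>" .
  moreover have "0 \<le> \<bar>\<mu>\<bar> * \<bar>y\<bar>" "0 \<le> \<bar>y\<bar>" by simp_all
  ultimately have "1 + \<bar>x\<bar> \<le> K * (1 + \<bar>y\<bar>)"
    using assms unfolding K_def ring_distribs by linarith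
  then have "(1 + \<bar>x\<bar>) powr \<beta> \<le> (K * (1 + \<bar>y\<bar>)) powr \<beta>"
    using bounds_pos by (intro powr_mono2) auto
  then have "(1 + \<bar>y\<bar>) powr (-\<beta>) \<le> K powr \<beta> * (1 + \<bar>x\<bar>) powr (-\<beta>)"
    using K by (subst (asm) powr_mult) (simp_all add: powr_minus field_simps)
  then have "(v\<^sub>0 + v\<^sub>1) * 2 powr \<beta> * (1 + \<bar>y\<bar>) powr (-\<beta>)
      \<le> (v\<^sub>0 + v\<^sub>1) * 2 powr \<beta> * (K powr \<beta> * (1 + \<bar>x\<bar>) powr (-\<beta>))"
    using bounds_pos by (intro mult_left_mono) auto
  with two have "\<phi> m y \<le> (v\<^sub>0 + v\<^sub>1) * 2 powr \<beta> * (K powr \<beta> * (1 + \<bar>x\<bar>) powr (-\<beta>))"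
    by linarith
  then show "loc_scale (\<phi> m) \<mu> \<sigma> x
      \<le> ((v\<^sub>0 + v\<^sub>1) * 2 powr \<beta> * (1 + \<bar>\<mu>\<bar> + \<sigma>) powr \<beta> / \<sigma>) * (1 + \<bar>x\<bar>) powr (-\<beta>)"
    using assms by (simp add: loc_scale_def y_def[symmetric] K_def[symmetric] divide_simps mult_ac)
qed

lemma nn_integral_loc_scale:
  assumes "0 < \<sigma>"
  shows "(\<integral>\<^sup>+x. ennreal (loc_scale (\<phi> m) \<mu> \<sigma> x) \<partial>lborel) = 1"
proof -
  have "1 = (\<integral>\<^sup>+x. ennreal (\<phi> m x) \<partial>lborel)"
    using densities[of m] by (simp add: prob_density_def)
  also have "\<dots> = \<bar>1 / \<sigma>\<bar> * (\<integral>\<^sup>+x. ennreal (\<phi> m (- (\<mu> / \<sigma>) + (1 / \<sigma>) * x)) \<partial>lborel)"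
    using assms by (intro nn_integral_real_affine) auto
  also have "\<dots> = (\<integral>\<^sup>+x. ennreal \<bar>1 / \<sigma>\<bar> * ennreal (\<phi> m (- (\<mu> / \<sigma>) + (1 / \<sigma>) * x)) \<partial>lborel)"
    by (rule nn_integral_cmult[symmetric]) measurable
  also have "\<dots> = (\<integral>\<^sup>+x. ennreal (loc_scale (\<phi> m) \<mu> \<sigma> x) \<partial>lborel)"
    using assms by (intro nn_integral_cong)
      (simp add: loc_scale_def ennreal_mult'[symmetric] diff_divide_distrib)
  finally show ?thesis by simp
qed

lemma nn_integral_weighted:
  assumes "\<And>m. m \<in> S \<Longrightarrow> 0 \<le> weight (\<theta> $ m)" "\<And>m. m \<in> S \<Longrightarrow> 0 < scale (\<theta> $ m)"
  shows "(\<integral>\<^sup>+x. ennreal (\<Sum>m\<in>S. weight (\<theta> $ m) * loc_scale (\<phi> m) (location (\<theta> $ m)) (scale (\<theta> $ m)) x)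
     \<partial>lborel) = ennreal (\<Sum>m\<in>S. weight (\<theta> $ m))"
proof -
  have "(\<integral>\<^sup>+x. ennreal (\<Sum>m\<in>S. weight (\<theta> $ m) * loc_scale (\<phi> m) (location (\<theta> $ m)) (scale (\<theta> $ m)) x)
     \<partial>lborel) = (\<integral>\<^sup>+x. (\<Sum>m\<in>S. ennreal (weight (\<theta> $ m)) *
        ennreal (loc_scale (\<phi> m) (location (\<theta> $ m)) (scale (\<theta> $ m)) x)) \<partial>lborel)"
    using assms by (intro nn_integral_cong)
      (simp add: sum_ennreal[symmetric] ennreal_mult loc_scale_nonneg)
  also have "\<dots> = (\<Sum>m\<in>S. ennreal (weight (\<theta> $ m)) *
        (\<integral>\<^sup>+x. ennreal (loc_scale (\<phi> m) (location (\<theta> $ m)) (scale (\<theta> $ m)) x) \<partial>lborel))"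
    by (subst nn_integral_sum) (simp_all add: nn_integral_cmult)
  also have "\<dots> = ennreal (\<Sum>m\<in>S. weight (\<theta> $ m))"
    using assms by (simp add: nn_integral_loc_scale)
  finally show ?thesis .
qed

lemma mixture_measurable [measurable]: "mixture \<phi> \<theta> \<in> borel_measurable borel"
  unfolding mixture_def by measurable

lemma mixture_nonneg: "\<theta> \<in> Params \<Longrightarrow> 0 \<le> mixture \<phi> \<theta> x"
  unfolding mixture_def Params_def by (auto intro!: sum_nonneg mult_nonneg_nonneg loc_scale_nonneg)

lemma nn_integral_mixture:
  "\<theta> \<in> Params \<Longrightarrow> (\<integral>\<^sup>+x. ennreal (mixture \<phi> \<theta> x) \<partial>lborel) = 1"
  unfolding mixture_def by (subst nn_integral_weighted) (auto simp: Params_def)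

lemma weight_le_1: "\<theta> \<in> Params \<Longrightarrow> weight (\<theta> $ m) \<le> 1"
  unfolding Params_def using member_le_sum[of m UNIV "\<lambda>m. weight (\<theta> $ m)"] by auto

lemma mixture_le:
  assumes "\<theta> \<in> Params" "0 < s" "\<And>m. s \<le> scale (\<theta> $ m)"
  shows "mixture \<phi> \<theta> x \<le> v\<^sub>0 / s"
proof -
  have "mixture \<phi> \<theta> x \<le> (\<Sum>m\<in>UNIV. weight (\<theta> $ m) * (v\<^sub>0 / s))"
    unfolding mixture_def
  proof (intro sum_mono mult_left_mono)
    fix m
    have "loc_scale (\<phi> m) (location (\<theta> $ m)) (scale (\<theta> $ m)) x \<le> v\<^sub>0 / scale (\<theta> $ m)"
      using assms(2) assms(3)[of m] by (intro loc_scale_le_height) linarith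
    also have "\<dots> \<le> v\<^sub>0 / s"
      using assms(2) assms(3)[of m] bounds_pos by (intro divide_left_mono) auto
    finally show "loc_scale (\<phi> m) (location (\<theta> $ m)) (scale (\<theta> $ m)) x \<le> v\<^sub>0 / s" .
  qed (use assms in \<open>auto simp: Params_def\<close>)
  also have "\<dots> = v\<^sub>0 / s"
    using assms by (subst sum_distrib_right[symmetric]) (simp add: Params_def)
  finally show ?thesis .
qed

lemma min_scale:
  assumes "\<theta> \<in> Params"
  obtains s where "0 < s" "\<And>m. s \<le> scale (\<theta> $ m)"
  using assms that[of "Min (range (\<lambda>m. scale (\<theta> $ m)))"]
  by (auto simp: Params_def)

lemma mixture_decay:
  assumes "\<theta> \<in> Params"
  shows "\<exists>C. \<forall>x. mixture \<phi> \<theta> x \<le> C * (1 + \<bar>x\<bar>) powr (-\<beta>)"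
proof -
  have "\<forall>m. \<exists>C. \<forall>x. loc_scale (\<phi> m) (location (\<theta> $ m)) (scale (\<theta> $ m)) x \<le> C * (1 + \<bar>x\<bar>) powr (-\<beta>)"
    using assms by (auto simp: Params_def intro!: loc_scale_decay)
  then obtain C where C: "\<And>m x. loc_scale (\<phi> m) (location (\<theta> $ m)) (scale (\<theta> $ m)) x
      \<le> C m * (1 + \<bar>x\<bar>) powr (-\<beta>)"
    by metis
  have "mixture \<phi> \<theta> x \<le> (\<Sum>m\<in>UNIV. weight (\<theta> $ m) * C m) * (1 + \<bar>x\<bar>) powr (-\<beta>)" for x
    unfolding mixture_def sum_distrib_right mult.assoc
    using assms C by (intro sum_mono mult_left_mono) (auto simp: Params_def)
  then show ?thesis by blast
qed

text \<open>Used with \<open>q = 1 - t\<close>: this power of the true density dominates the integrands of all affinities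
  with bounded functions.\<close>

lemma nn_integral_mixture_powr:
  assumes "\<theta> \<in> Params" "1 < \<beta> * q" "0 < q"
  shows "(\<integral>\<^sup>+x. ennreal (mixture \<phi> \<theta> x powr q) \<partial>lborel) < \<infinity>"
proof -
  obtain C where C: "\<And>x. mixture \<phi> \<theta> x \<le> C * (1 + \<bar>x\<bar>) powr (-\<beta>)"
    using mixture_decay[OF assms(1)] by blast
  have C0: "0 \<le> C"
    using C[of 0] mixture_nonneg[OF assms(1), of 0] by simp
  have "mixture \<phi> \<theta> x powr q \<le> C powr q * (1 + \<bar>x\<bar>) powr (-(\<beta> * q))" for x
  proof -
    have "mixture \<phi> \<theta> x powr q \<le> (C * (1 + \<bar>x\<bar>) powr (-\<beta>)) powr q"
      using C assms mixture_nonneg by (intro powr_mono2) auto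
    also have "\<dots> = C powr q * (1 + \<bar>x\<bar>) powr (-(\<beta> * q))"
      using C0 by (simp add: powr_mult powr_powr)
    finally show ?thesis .
  qed
  then have "(\<integral>\<^sup>+x. ennreal (mixture \<phi> \<theta> x powr q) \<partial>lborel)
      \<le> (\<integral>\<^sup>+x. ennreal (C powr q) * ennreal ((1 + \<bar>x\<bar>) powr (-(\<beta> * q))) \<partial>lborel)"
    by (intro nn_integral_mono) (simp add: ennreal_mult[symmetric])
  also have "\<dots> = ennreal (C powr q) * (\<integral>\<^sup>+x. ennreal ((1 + \<bar>x\<bar>) powr (-(\<beta> * q))) \<partial>lborel)"
    by (rule nn_integral_cmult) measurable
  also have "\<dots> < \<infinity>"
    using nn_integral_powr_lt_top[OF assms(2)] by (simp add: ennreal_mult_less_top)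
  finally show ?thesis .
qed

end

section \<open>The affinity of order t between two densities\<close>

text \<open>For positive \<open>a\<close> and \<open>b\<close>, with \<open>u = ln a - ln b\<close>, this is the strict convexity of the exponential function between 0 and
  \<open>u\<close>: its tangent at \<open>t * u\<close> lies strictly below it at both ends.\<close>

lemma young_powr_strict:
  fixes a b t :: real
  assumes "0 \<le> a" "0 \<le> b" "0 < t" "t < 1"
  shows "a powr t * b powr (1 - t) \<le> t * a + (1 - t) * b"
    and "a powr t * b powr (1 - t) = t * a + (1 - t) * b \<Longrightarrow> a = b"
proof -
  have main: "a powr t * b powr (1 - t) < t * a + (1 - t) * b" if "a \<noteq> b"
  proof (cases "a = 0 \<or> b = 0")
    case True
    with that assms show ?thesis by (auto simp: add_pos_nonneg less_le)
  next
    case False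
    with assms have pos: "0 < a" "0 < b" by auto
    define u where "u = ln a - ln b"
    have u: "u \<noteq> 0" using pos that by (simp add: u_def)
    \<comment> \<open>the tangent at \<open>t * u\<close>, after division by \<open>exp (t * u)\<close>\<close>
    have tangent: "1 + x < exp x" if "x \<noteq> 0" for x :: real
      using ln_eq_minus_one[of "exp x"] exp_ge_add_one_self[of x] that by (auto simp: less_le)
    have "exp (t * u) * (t * (1 + (1 - t) * u) + (1 - t) * (1 + - t * u))
        < exp (t * u) * (t * exp ((1 - t) * u) + (1 - t) * exp (- t * u))"
      using u assms by (intro mult_strict_left_mono add_strict_mono mult_strict_left_mono tangent) auto
    also have "\<dots> = t * (exp (t * u) * exp ((1 - t) * u)) + (1 - t) * (exp (t * u) * exp (- t * u))"
      by (simp only: ring_distribs mult_ac)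
    also have "\<dots> = t * exp u + (1 - t)"
      by (simp add: exp_add[symmetric] algebra_simps)
    finally have "exp (t * u) < t * exp u + (1 - t)"
      by (simp add: algebra_simps)
    then have "b * exp (t * u) < b * (t * exp u + (1 - t))" using pos by simp
    moreover have "b * exp u = a" using pos by (simp add: u_def exp_diff)
    moreover have "b * exp (t * u) = a powr t * b powr (1 - t)"
    proof -
      have "b * exp (t * u) = exp (ln b + t * u)" using pos by (simp add: exp_add)
      also have "ln b + t * u = t * ln a + (1 - t) * ln b" by (simp add: u_def algebra_simps)
      finally show ?thesis using pos by (simp add: powr_def exp_add)
    qed
    moreover have "b * (t * exp u + (1 - t)) = t * (b * exp u) + (1 - t) * b"
      by (simp add: algebra_simps)
    ultimately show ?thesis by simp
  qed
  show "a powr t * b powr (1 - t) \<le> t * a + (1 - t) * b"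
  proof (cases "a = b")
    case True
    with assms show ?thesis by (simp add: powr_add[symmetric] algebra_simps)
  qed (use main in auto)
  show "a powr t * b powr (1 - t) = t * a + (1 - t) * b \<Longrightarrow> a = b"
    using main by fastforce
qed

text \<open>Integrating Young's inequality bounds the affinity by 1, and its equality case shows that the
  bound is not attained by two different densities.\<close>

lemma affinity_less_one:
  fixes p q :: "real \<Rightarrow> real"
  assumes [measurable]: "p \<in> borel_measurable borel" "q \<in> borel_measurable borel"
    and nonneg: "\<And>x. 0 \<le> p x" "\<And>x. 0 \<le> q x"
    and int: "(\<integral>\<^sup>+x. ennreal (p x) \<partial>lborel) = 1" "(\<integral>\<^sup>+x. ennreal (q x) \<partial>lborel) = 1"
    and neq: "\<not> (AE x in lborel. p x = q x)" and t: "0 < t" "t < 1"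
  shows "(\<integral>\<^sup>+x. ennreal (p x powr t * q x powr (1 - t)) \<partial>lborel) < 1"
proof -
  let ?m = "\<lambda>x. t * p x + (1 - t) * q x"
  have "(\<integral>\<^sup>+x. ennreal (?m x) \<partial>lborel)
      = (\<integral>\<^sup>+x. ennreal t * ennreal (p x) + ennreal (1 - t) * ennreal (q x) \<partial>lborel)"
    using t nonneg by (intro nn_integral_cong) (simp add: ennreal_mult[symmetric] ennreal_plus[symmetric] del: ennreal_plus)
  also have "\<dots> = ennreal t + ennreal (1 - t)"
    by (subst nn_integral_add) (simp_all add: nn_integral_cmult int)
  also have "\<dots> = 1"
    using t by (simp add: ennreal_plus[symmetric] del: ennreal_plus)
  finally have mean: "(\<integral>\<^sup>+x. ennreal (?m x) \<partial>lborel) = 1" .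
  have le: "p x powr t * q x powr (1 - t) \<le> ?m x" for x
    using young_powr_strict(1)[of "p x" "q x" t] nonneg t by simp
  have "(\<integral>\<^sup>+x. ennreal (p x powr t * q x powr (1 - t)) \<partial>lborel) < (\<integral>\<^sup>+x. ennreal (?m x) \<partial>lborel)"
  proof (rule nn_integral_less)
    have "(\<integral>\<^sup>+x. ennreal (p x powr t * q x powr (1 - t)) \<partial>lborel) \<le> (\<integral>\<^sup>+x. ennreal (?m x) \<partial>lborel)"
      using le by (intro nn_integral_mono ennreal_leI)
    then show "(\<integral>\<^sup>+x. ennreal (p x powr t * q x powr (1 - t)) \<partial>lborel) \<noteq> \<infinity>"
      by (auto simp: mean top_unique)
    show "AE x in lborel. ennreal (p x powr t * q x powr (1 - t)) \<le> ennreal (?m x)"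
      using le by (intro AE_I2 ennreal_leI)
    have "p x = q x" if "ennreal (?m x) \<le> ennreal (p x powr t * q x powr (1 - t))" for x
    proof -
      have "?m x \<le> p x powr t * q x powr (1 - t)"
        using that by (subst (asm) ennreal_le_iff) auto
      with le[of x] show ?thesis
        using young_powr_strict(2)[of "p x" "q x" t] nonneg t by simp
    qed
    then show "\<not> (AE x in lborel. ennreal (?m x) \<le> ennreal (p x powr t * q x powr (1 - t)))"
      using neq by (blast intro: eventually_mono)
  qed simp_all
  with mean show ?thesis by simp
qed

text \<open>Dominated convergence. The functions \<open>H k\<close> are only bounded, not integrable, so the
  dominating function is a multiple of \<open>mixture \<phi> \<theta> powr (1 - t)\<close>.\<close>

lemma (in loc_scale_families) affinity_tendsto:
  fixes H :: "nat \<Rightarrow> real \<Rightarrow> real"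
  assumes "\<theta> \<in> Params" and t: "0 < t" "1 < \<beta> * (1 - t)"
    and [measurable]: "\<And>k. H k \<in> borel_measurable borel" "G \<in> borel_measurable borel"
    and bound: "\<And>k x. 0 \<le> H k x" "\<And>k x. H k x \<le> C"
    and lim: "AE x in lborel. (\<lambda>k. H k x) \<longlonglongrightarrow> G x"
  shows "(\<lambda>k. \<integral>\<^sup>+x. ennreal (H k x powr t * mixture \<phi> \<theta> x powr (1 - t)) \<partial>lborel)
    \<longlonglongrightarrow> (\<integral>\<^sup>+x. ennreal (G x powr t * mixture \<phi> \<theta> x powr (1 - t)) \<partial>lborel)"
proof (rule nn_integral_dominated_convergence)
  show "AE x in lborel. ennreal (H k x powr t * mixture \<phi> \<theta> x powr (1 - t))
      \<le> ennreal (C powr t) * ennreal (mixture \<phi> \<theta> x powr (1 - t))" for k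
    using bound t by (intro AE_I2) (auto simp: ennreal_mult[symmetric] intro!: ennreal_leI mult_right_mono powr_mono2)
  have "0 < \<beta> * (1 - t)" using t by simp
  then have q: "0 < 1 - t" using bounds_pos by (simp add: zero_less_mult_iff)
  show "(\<integral>\<^sup>+x. ennreal (C powr t) * ennreal (mixture \<phi> \<theta> x powr (1 - t)) \<partial>lborel) < \<infinity>"
    using nn_integral_mixture_powr[OF assms(1) t(2) q]
    by (subst nn_integral_cmult) (simp_all add: ennreal_mult_less_top)
  show "AE x in lborel. (\<lambda>k. ennreal (H k x powr t * mixture \<phi> \<theta> x powr (1 - t)))
      \<longlonglongrightarrow> ennreal (G x powr t * mixture \<phi> \<theta> x powr (1 - t))"
    using lim
  proof eventually_elim
    case (elim x)
    then show ?case
      using t bound by (intro tendsto_ennrealI tendsto_mult_right tendsto_powr2 tendsto_const) auto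
  qed
qed simp_all

section \<open>Measurable envelopes of nearby mixtures\<close>

lemma scale_lipschitz: "\<bar>scale (\<theta>' $ m) - scale (\<theta> $ m)\<bar> \<le> dist \<theta>' (\<theta> :: 'm::finite param)"
proof -
  have "dist (scale (\<theta>' $ m)) (scale (\<theta> $ m)) \<le> dist (\<theta>' $ m) (\<theta> $ m)"
    by (meson dist_snd_le order_trans)
  also have "\<dots> \<le> dist \<theta>' \<theta>" by (rule dist_vec_nth_le)
  finally show ?thesis by (simp add: dist_real_def)
qed

text \<open>The condition \<open>0 < scale\<close> is not closed, but on a ball whose radius is less than all scales of its
  center it holds automatically.\<close>

lemma compact_Params_ball:
  assumes "0 < s" "\<And>m. s \<le> scale (\<theta> $ m)" "\<rho> < s"
  shows "compact {\<theta>' \<in> Params. dist \<theta>' (\<theta> :: 'm::finite param) \<le> \<rho>}"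
proof -
  let ?K = "{\<theta>'. \<forall>m. 0 \<le> weight (\<theta>' $ m)} \<inter> {\<theta>'. (\<Sum>m\<in>UNIV. weight (\<theta>' $ m)) = 1} \<inter> cball \<theta> \<rho>"
  have "{\<theta>' \<in> Params. dist \<theta>' \<theta> \<le> \<rho>} = ?K"
  proof -
    have "0 < scale (\<theta>' $ m)" if "dist \<theta>' \<theta> \<le> \<rho>" for \<theta>' m
      using scale_lipschitz[of \<theta>' m \<theta>] that assms(2)[of m] assms(3) by linarith
    then show ?thesis by (auto simp: Params_def dist_commute)
  qed
  moreover have "closed {\<theta>' :: 'm param. \<forall>m. 0 \<le> weight (\<theta>' $ m)}"
    by (intro closed_Collect_all closed_Collect_le continuous_intros)
  moreover have "closed {\<theta>' :: 'm param. (\<Sum>m\<in>UNIV. weight (\<theta>' $ m)) = 1}"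
    by (intro closed_Collect_eq continuous_intros)
  ultimately show ?thesis
    by (simp add: closed_Int_compact closed_Int)
qed

locale regular_mixture = loc_scale_families \<phi> v\<^sub>0 v\<^sub>1 \<beta>
  for \<phi> :: "'m::finite \<Rightarrow> real \<Rightarrow> real" and v\<^sub>0 v\<^sub>1 \<beta> :: real +
  assumes sup_measurable:
      "\<And>\<Gamma> \<theta>. compact \<Gamma> \<Longrightarrow> \<Gamma> \<subseteq> Params \<Longrightarrow> \<theta> \<in> \<Gamma> \<Longrightarrow>
         \<forall>\<^sub>F \<rho> in at_right 0.
           (\<lambda>x. SUP \<theta>'\<in>{\<theta>'\<in>Params. dist \<theta>' \<theta> \<le> \<rho>}. ennreal (mixture \<phi> \<theta>' x))
             \<in> borel_measurable lebesgue"
    and ae_continuous: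
      "\<And>\<Gamma> \<theta>. compact \<Gamma> \<Longrightarrow> \<Gamma> \<subseteq> Params \<Longrightarrow> \<theta> \<in> \<Gamma> \<Longrightarrow>
         AE x in lborel. \<forall>s. (\<forall>j. s j \<in> \<Gamma>) \<and> s \<longlonglongrightarrow> \<theta> \<longrightarrow>
           (\<lambda>j. mixture \<phi> (s j) x) \<longlonglongrightarrow> mixture \<phi> \<theta> x"
begin

text \<open>At every \<open>x\<close> where the density is continuous in the parameter, its suprema over shrinking
  balls of parameters decrease to the value at the center. As functions of \<open>x\<close> these suprema are only Lebesgue measurable; \<open>V\<close>
  consists of Borel versions, which is why domination holds off a null set.\<close>

lemma measurable_envelope:
  assumes \<theta>: "\<theta> \<in> Params"
  obtains \<rho> :: "nat \<Rightarrow> real" and V :: "nat \<Rightarrow> real \<Rightarrow> real" and C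
  where "\<And>k. 0 < \<rho> k" "\<And>k. V k \<in> borel_measurable borel"
    "\<And>k x. 0 \<le> V k x" "\<And>k x. V k x \<le> C"
    "\<And>k. AE x in lborel. \<forall>\<theta>'\<in>Params. dist \<theta>' \<theta> \<le> \<rho> k \<longrightarrow> mixture \<phi> \<theta>' x \<le> V k x"
    "AE x in lborel. (\<lambda>k. V k x) \<longlonglongrightarrow> mixture \<phi> \<theta> x"
proof -
  obtain s where s: "0 < s" "\<And>m. s \<le> scale (\<theta> $ m)"
    using min_scale[OF \<theta>] by blast
  define \<Gamma> where "\<Gamma> = {\<theta>' \<in> Params. dist \<theta>' \<theta> \<le> s / 2}"
  have \<Gamma>: "compact \<Gamma>" "\<Gamma> \<subseteq> Params" "\<theta> \<in> \<Gamma>"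
    using compact_Params_ball[of s \<theta> "s / 2"] s \<theta> by (auto simp: \<Gamma>_def)
  define U where "U r x = (SUP \<theta>'\<in>{\<theta>'\<in>Params. dist \<theta>' \<theta> \<le> r}. ennreal (mixture \<phi> \<theta>' x))" for r x
  obtain b where b: "0 < b" "\<And>r. 0 < r \<Longrightarrow> r < b \<Longrightarrow> U r \<in> borel_measurable lebesgue"
    using sup_measurable[OF \<Gamma>] unfolding U_def[symmetric] eventually_at_right_field by auto
  define \<rho> where "\<rho> k = min (s / 2) (b / 2) / (real k + 1)" for k
  have \<rho>: "0 < \<rho> k" "\<rho> k \<le> s / 2" "\<rho> k < b" for k
  proof -
    show "0 < \<rho> k" using s b by (simp add: \<rho>_def)
    have "\<rho> k \<le> min (s / 2) (b / 2) / 1"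
      unfolding \<rho>_def using s b by (intro divide_left_mono) auto
    with b show "\<rho> k \<le> s / 2" "\<rho> k < b" by auto
  qed
  have \<rho>_anti: "\<rho> k \<le> \<rho> n" if "n \<le> k" for k n
    unfolding \<rho>_def using s b that by (intro divide_left_mono) auto
  have \<rho>_lim: "\<rho> \<longlonglongrightarrow> 0"
    unfolding \<rho>_def by real_asymp
  define C where "C = v\<^sub>0 / (s / 2)"
  have C: "0 \<le> C" using s bounds_pos by (simp add: C_def)
  have le_C: "mixture \<phi> \<theta>' x \<le> C" if "\<theta>' \<in> Params" "dist \<theta>' \<theta> \<le> \<rho> k" for \<theta>' k x
    unfolding C_def
  proof (rule mixture_le)
    show "s / 2 \<le> scale (\<theta>' $ m)" for m
      using scale_lipschitz[of \<theta>' m \<theta>] that(2) \<rho>(2)[of k] s(2)[of m] by (simp add: abs_if split: if_splits)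
  qed (use s that in auto)
  have U_le: "U (\<rho> k) x \<le> ennreal C" for k x
    unfolding U_def using le_C by (intro SUP_least ennreal_leI) auto
  have "\<forall>k. \<exists>W\<in>borel_measurable lborel. AE x in lborel. U (\<rho> k) x = W x"
    using b(2) \<rho> by (intro allI completion_ex_borel_measurable) auto
  from choice[OF this[unfolded Bex_def]]
  obtain W where W: "\<And>k. W k \<in> borel_measurable borel"
      "\<And>k. AE x in lborel. U (\<rho> k) x = W k x"
    by auto
  \<comment> \<open>cut off at \<open>C\<close>, as the Borel version \<open>W\<close> is bounded only almost everywhere\<close>
  define V where "V k x = min C (enn2real (W k x))" for k x
  have "AE x in lborel. \<forall>k. U (\<rho> k) x = W k x"
    using W(2) by (simp add: AE_all_countable)
  then have AE_V: "AE x in lborel. \<forall>k. ennreal (V k x) = U (\<rho> k) x"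
  proof eventually_elim
    case (elim x)
    have "ennreal (enn2real (U (\<rho> k) x)) = U (\<rho> k) x" for k
      by (rule ennreal_enn2real) (rule le_less_trans[OF U_le ennreal_less_top])
    moreover have "enn2real (U (\<rho> k) x) \<le> C" for k
      by (rule enn2real_leI[OF C U_le])
    ultimately show ?case using elim by (simp add: V_def min_absorb2)
  qed
  show ?thesis
  proof (rule that[of \<rho> V C])
    show "V k \<in> borel_measurable borel" for k
      using W(1)[of k, measurable] unfolding V_def by measurable
    show "0 \<le> V k x" "V k x \<le> C" for k x using C by (auto simp: V_def)
    show "AE x in lborel. \<forall>\<theta>'\<in>Params. dist \<theta>' \<theta> \<le> \<rho> k \<longrightarrow> mixture \<phi> \<theta>' x \<le> V k x" for k
      using AE_V
    proof eventually_elim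
      case (elim x)
      have "ennreal (mixture \<phi> \<theta>' x) \<le> ennreal (V k x)" if "\<theta>' \<in> Params" "dist \<theta>' \<theta> \<le> \<rho> k" for \<theta>'
        unfolding elim[rule_format] U_def using that by (intro SUP_upper) auto
      then show ?case using C by (auto simp: ennreal_le_iff V_def)
    qed
    show "AE x in lborel. (\<lambda>k. V k x) \<longlonglongrightarrow> mixture \<phi> \<theta> x"
      using AE_V ae_continuous[OF \<Gamma>]
    proof eventually_elim
      case (elim x)
      have lower: "mixture \<phi> \<theta> x \<le> V k x" for k
      proof -
        have "ennreal (mixture \<phi> \<theta> x) \<le> ennreal (V k x)"
          unfolding elim(1)[rule_format] U_def using \<theta> \<rho>(1)[of k] by (intro SUP_upper) auto
        then show ?thesis using C by (simp add: ennreal_le_iff V_def)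
      qed
      show ?case
      proof (rule ccontr)
        assume "\<not> (\<lambda>k. V k x) \<longlonglongrightarrow> mixture \<phi> \<theta> x"
        then obtain e where e: "0 < e" "\<And>n. \<exists>k\<ge>n. \<not> dist (V k x) (mixture \<phi> \<theta> x) < e"
          unfolding lim_sequentially by blast
        have "\<exists>\<theta>'. \<theta>' \<in> Params \<and> dist \<theta>' \<theta> \<le> \<rho> n \<and> mixture \<phi> \<theta> x + e / 2 < mixture \<phi> \<theta>' x" for n
        proof -
          obtain k where k: "n \<le> k" "\<not> dist (V k x) (mixture \<phi> \<theta> x) < e" using e(2) by blast
          have "mixture \<phi> \<theta> x + e / 2 < V k x"
            using k(2) lower[of k] e(1) by (auto simp: dist_real_def abs_if split: if_splits)
          then have "ennreal (mixture \<phi> \<theta> x + e / 2) < U (\<rho> k) x"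
            unfolding elim(1)[rule_format, symmetric]
            using mixture_nonneg[OF \<theta>, of x] e(1) by (subst ennreal_less_iff) auto
          then obtain \<theta>' where "\<theta>' \<in> Params" "dist \<theta>' \<theta> \<le> \<rho> k"
              "ennreal (mixture \<phi> \<theta> x + e / 2) < ennreal (mixture \<phi> \<theta>' x)"
            unfolding U_def less_SUP_iff by auto
          with \<rho>_anti[OF k(1)] mixture_nonneg[OF \<theta>, of x] e(1) show ?thesis
            by (intro exI[of _ \<theta>']) (auto simp: ennreal_less_iff simp del: ennreal_plus)
        qed
        then obtain z where z: "\<And>n. z n \<in> Params" "\<And>n. dist (z n) \<theta> \<le> \<rho> n"
            "\<And>n. mixture \<phi> \<theta> x + e / 2 < mixture \<phi> (z n) x"
          by metis
        have "z \<longlonglongrightarrow> \<theta>"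
          unfolding tendsto_dist_iff[of z]
          by (rule tendsto_sandwich[OF _ _ tendsto_const \<rho>_lim]) (auto simp: z)
        moreover have "z n \<in> \<Gamma>" for n
          using z(1)[of n] z(2)[of n] \<rho>(2)[of n] by (simp add: \<Gamma>_def)
        ultimately have "(\<lambda>n. mixture \<phi> (z n) x) \<longlonglongrightarrow> mixture \<phi> \<theta> x"
          using elim(2) by blast
        then have "mixture \<phi> \<theta> x + e / 2 \<le> mixture \<phi> \<theta> x"
          using z(3) by (intro tendsto_lowerbound[OF _ always_eventually]) (auto intro: less_imp_le)
        with e(1) show False by simp
      qed
    qed
  qed (use \<rho> in auto)
qed

end

section \<open>Likelihood ratios along the sample\<close>

locale mixture_sample = regular_mixture \<phi> v\<^sub>0 v\<^sub>1 \<beta> + prob_space P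
  for \<phi> :: "'m::finite \<Rightarrow> real \<Rightarrow> real" and v\<^sub>0 v\<^sub>1 \<beta> :: real and P :: "'w measure" +
  fixes \<theta>\<^sub>0 :: "'m param" and X :: "nat \<Rightarrow> 'w \<Rightarrow> real"
  assumes true_param: "\<theta>\<^sub>0 \<in> Params"
    and sample_indep: "indep_vars (\<lambda>_. borel) X {1..}"
    and sample_distr:
      "\<And>i. 1 \<le> i \<Longrightarrow> distributed P lborel (X i) (\<lambda>x. ennreal (mixture \<phi> \<theta>\<^sub>0 x))"
begin

abbreviation f\<^sub>0 :: "real \<Rightarrow> real" where "f\<^sub>0 \<equiv> mixture \<phi> \<theta>\<^sub>0"

lemma sample_measurable: "1 \<le> i \<Longrightarrow> X i \<in> borel_measurable P"
  using distributed_measurable[OF sample_distr] by simp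

text \<open>The sample almost surely avoids the zeros of the true density, so \<open>Q\<close> is assumed only elsewhere.\<close>

lemma AE_sample:
  assumes "AE x in lborel. 0 < f\<^sub>0 x \<longrightarrow> Q x"
  shows "AE \<omega> in P. \<forall>i\<ge>1. Q (X i \<omega>)"
proof -
  have "AE \<omega> in P. Q (X i \<omega>)" if i: "1 \<le> i" for i
  proof (rule AE_distrD[where f="X i" and M'=lborel and P=Q])
    show "X i \<in> measurable P lborel" using sample_measurable[OF i] by simp
    show "AE x in distr P lborel (X i). Q x"
      unfolding distributed_distr_eq_density[OF sample_distr[OF i]]
      using assms by (subst AE_density) auto
  qed
  then show ?thesis by (subst AE_all_countable) auto
qed

lemma nn_integral_sample_prod:
  assumes [measurable]: "g \<in> borel_measurable borel"
  shows "(\<integral>\<^sup>+\<omega>. (\<Prod>i=1..n. g (X i \<omega>)) \<partial>P) = (\<integral>\<^sup>+x. ennreal (f\<^sub>0 x) * g x \<partial>lborel) ^ n"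
proof -
  have "indep_vars (\<lambda>_. borel) (\<lambda>i \<omega>. g (X i \<omega>)) {1..n}"
    by (rule indep_vars_compose2[OF indep_vars_subset[OF sample_indep]]) auto
  then have "(\<integral>\<^sup>+\<omega>. (\<Prod>i=1..n. g (X i \<omega>)) \<partial>P) = (\<Prod>i=1..n. \<integral>\<^sup>+\<omega>. g (X i \<omega>) \<partial>P)"
    by (intro indep_vars_nn_integral) auto
  also have "\<dots> = (\<Prod>i=1..n. \<integral>\<^sup>+x. ennreal (f\<^sub>0 x) * g x \<partial>lborel)"
    by (intro prod.cong refl distributed_nn_integral[OF sample_distr, symmetric]) auto
  finally show ?thesis by simp
qed

text \<open>Markov's inequality for the product of the independent ratios \<open>(H (X i) / f\<^sub>0 (X i)) powr t\<close>,
  whose expectations are the affinity, gives a geometric series of probabilities; the Borel-Cantelli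
  lemma finishes. The factor \<open>exp (- \<delta> * n)\<close> is the room that narrow components may use up later.\<close>

lemma likelihood_ratio_decay:
  assumes [measurable]: "H \<in> borel_measurable borel" and H: "\<And>x. 0 \<le> H x" and t: "0 < t"
    and less: "(\<integral>\<^sup>+x. ennreal (H x powr t * f\<^sub>0 x powr (1 - t)) \<partial>lborel) < ennreal (exp (- t * \<delta>))"
  shows "AE \<omega> in P. \<forall>\<^sub>F n in sequentially.
    (\<Prod>i=1..n. H (X i \<omega>)) < exp (- \<delta> * real n) * (\<Prod>i=1..n. f\<^sub>0 (X i \<omega>))"
proof -
  define g where "g x = (H x / f\<^sub>0 x) powr t" for x
  have [measurable]: "g \<in> borel_measurable borel" unfolding g_def by measurable
  define a where "a = enn2real (\<integral>\<^sup>+x. ennreal (H x powr t * f\<^sub>0 x powr (1 - t)) \<partial>lborel)"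
  have a: "0 \<le> a" "(\<integral>\<^sup>+x. ennreal (H x powr t * f\<^sub>0 x powr (1 - t)) \<partial>lborel) = ennreal a"
    using less_trans[OF less ennreal_less_top] by (simp_all add: a_def)
  have a_less: "a < exp (- t * \<delta>)"
    using less a by (simp add: ennreal_less_iff)
  have int: "(\<integral>\<^sup>+x. ennreal (f\<^sub>0 x) * ennreal (g x) \<partial>lborel) = ennreal a"
    unfolding a(2)[symmetric]
  proof (rule nn_integral_cong)
    fix x
    have "f\<^sub>0 x * g x = H x powr t * f\<^sub>0 x powr (1 - t)"
    proof (cases "f\<^sub>0 x = 0")
      case False
      then have "0 < f\<^sub>0 x" using mixture_nonneg[OF true_param, of x] by simp
      then show ?thesis using H by (simp add: g_def powr_divide powr_diff)
    qed (simp add: g_def)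
    then show "ennreal (f\<^sub>0 x) * ennreal (g x) = ennreal (H x powr t * f\<^sub>0 x powr (1 - t))"
      by (subst ennreal_mult[symmetric]) (auto simp: g_def mixture_nonneg[OF true_param])
  qed
  define q where "q = a * exp (t * \<delta>)"
  have "a * exp (t * \<delta>) < exp (- t * \<delta>) * exp (t * \<delta>)" using a_less by simp
  then have q: "0 \<le> q" "q < 1" using a by (auto simp: q_def simp flip: exp_add)
  define bad where "bad n = {\<omega> \<in> space P. exp (- t * \<delta> * real n) \<le> (\<Prod>i=1..n. g (X i \<omega>))}" for n
  have meas: "(\<lambda>\<omega>. \<Prod>i=1..n. g (X i \<omega>)) \<in> borel_measurable P" for n
    using sample_measurable by (intro borel_measurable_prod measurable_compose[of _ P borel g]) auto
  have bad_events: "bad n \<in> events" for n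
    unfolding bad_def using meas[of n] by measurable
  have "prob (bad n) \<le> q ^ n" for n
  proof -
    let ?e = "exp (- t * \<delta> * real n)"
    have "ennreal (?e * prob (bad n)) = (\<integral>\<^sup>+\<omega>. ennreal ?e * indicator (bad n) \<omega> \<partial>P)"
      using bad_events by (simp add: nn_integral_cmult_indicator emeasure_eq_measure ennreal_mult)
    also have "\<dots> \<le> (\<integral>\<^sup>+\<omega>. (\<Prod>i=1..n. ennreal (g (X i \<omega>))) \<partial>P)"
      by (intro nn_integral_mono) (auto simp: bad_def prod_ennreal g_def split: split_indicator intro!: ennreal_leI)
    also have "\<dots> = ennreal (a ^ n)"
      using nn_integral_sample_prod[of "\<lambda>x. ennreal (g x)" n] a by (simp add: int ennreal_power)
    finally have "?e * prob (bad n) \<le> a ^ n" using a by (simp add: ennreal_le_iff)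
    then have "exp (t * \<delta> * real n) * (?e * prob (bad n)) \<le> exp (t * \<delta> * real n) * a ^ n"
      by (intro mult_left_mono) auto
    also have "\<dots> = q ^ n"
      by (simp add: q_def power_mult_distrib exp_of_nat_mult[symmetric] mult_ac)
    also have "exp (t * \<delta> * real n) * (?e * prob (bad n)) = prob (bad n)"
      by (simp add: mult.assoc[symmetric] exp_add[symmetric])
    finally show ?thesis .
  qed
  then have "summable (\<lambda>n. prob (bad n))"
    using q by (intro summable_comparison_test'[OF summable_geometric[of q]]) auto
  then have "AE \<omega> in P. \<forall>\<^sub>F n in sequentially. \<omega> \<in> space P - bad n"
    using bad_events by (intro borel_cantelli_AE1) (auto simp: emeasure_eq_measure)
  moreover have "AE \<omega> in P. \<forall>i\<ge>1. 0 < f\<^sub>0 (X i \<omega>)"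
    by (rule AE_sample) simp
  ultimately show ?thesis
  proof eventually_elim
    case (elim \<omega>)
    show ?case using elim(1)
    proof eventually_elim
      fix n assume n: "\<omega> \<in> space P - bad n"
      let ?h = "\<Prod>i=1..n. H (X i \<omega>)" and ?f = "\<Prod>i=1..n. f\<^sub>0 (X i \<omega>)"
      have f: "0 < ?f" using elim(2) by (intro prod_pos) auto
      have h: "0 \<le> ?h" using H by (intro prod_nonneg) auto
      have "(?h / ?f) powr t = (\<Prod>i=1..n. g (X i \<omega>))"
        using H elim(2) by (simp add: g_def prod_dividef[symmetric] prod_powr_distrib mixture_nonneg[OF true_param])
      also have "\<dots> < exp (- t * \<delta> * real n)"
        using n by (simp add: bad_def not_le)
      also have "\<dots> = exp (- \<delta> * real n) powr t"
        by (simp add: powr_def mult_ac)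
      finally have "?h / ?f < exp (- \<delta> * real n)"
        using t powr_mono2[of t "exp (- \<delta> * real n)" "?h / ?f"] by (auto simp: not_le[symmetric])
      then show "?h < exp (- \<delta> * real n) * ?f"
        using f by (simp add: pos_divide_less_eq)
    qed
  qed
qed

end

section \<open>Numbers of observations in short intervals\<close>

lemma exp_minus_one_le: "exp y - 1 \<le> y * exp (y::real)"
proof -
  have "1 - y \<le> exp (- y)" using exp_ge_add_one_self[of "-y"] by simp
  then have "exp y * (1 - y) \<le> exp y * exp (- y)" by (intro mult_left_mono) auto
  then show ?thesis by (simp add: algebra_simps exp_minus)
qed

lemma floor_within_one:
  "a \<le> b + 1 \<Longrightarrow> b - 1 \<le> a \<Longrightarrow> \<lfloor>a::real\<rfloor> \<in> {\<lfloor>b\<rfloor> - 1, \<lfloor>b\<rfloor>, \<lfloor>b\<rfloor> + 1}"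
  using floor_mono[of a "b + 1"] floor_mono[of "b - 1" a] by auto

lemma indicator_le_sum3:
  "x \<in> A \<or> x \<in> B \<or> x \<in> C \<Longrightarrow> indicator D x \<le> (indicator A x + indicator B x + indicator C x :: real)"
  by (auto simp: indicator_def)

lemma count_arithmetic:
  fixes a b l B :: real
  assumes "B * a \<le> B * (2 * b + 1)" "0 \<le> l" "0 \<le> b" "0 \<le> B"
  shows "3 * (2 * (B * a) + 4 * l) \<le> (12 * B + 12) * (b + 1 + l)"
proof -
  have "B * a \<le> 2 * (B * b) + B" using assms(1) by (simp add: algebra_simps)
  moreover have "0 \<le> B * b" "0 \<le> B * l" using assms by auto
  moreover have "(12 * B + 12) * (b + 1 + l) = 12 * (B * b) + 12 * B + 12 * (B * l) + 12 * b + 12 + 12 * l"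
    by (simp add: algebra_simps)
  ultimately show ?thesis using assms(3,4) by simp
qed

context mixture_sample
begin

text \<open>The cells of a fixed scale form a grid on the line. An interval of radius at most \<open>s\<close> meets at
  most three neighbouring cells of scale \<open>s\<close>, so counts in cells bound counts in all intervals.\<close>

definition cell :: "real \<Rightarrow> int \<Rightarrow> real set" where "cell s k = {x. \<lfloor>x / s\<rfloor> = k}"

definition cell_count :: "real \<Rightarrow> int \<Rightarrow> nat \<Rightarrow> 'w \<Rightarrow> real" where
  "cell_count s k n \<omega> = (\<Sum>i=1..n. indicator (cell s k) (X i \<omega>))"

lemma cell_measurable [measurable]: "cell s k \<in> sets borel"
  unfolding cell_def by measurable

lemma cell_count_measurable [measurable]: "cell_count s k n \<in> borel_measurable P"
  unfolding cell_count_def using sample_measurable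
  by (intro borel_measurable_sum measurable_compose[OF _ borel_measurable_indicator]) auto

definition sample_law :: "real measure" where "sample_law = density lborel (\<lambda>x. ennreal (f\<^sub>0 x))"

lemma prob_space_sample_law: "prob_space sample_law"
  unfolding sample_law_def by (rule prob_spaceI) (simp add: emeasure_density nn_integral_mixture true_param)

lemma measure_cell_le:
  assumes "0 < s" "0 \<le> B" "\<And>x. f\<^sub>0 x \<le> B"
  shows "measure sample_law (cell s k) \<le> B * s"
proof -
  have sub: "cell s k \<subseteq> {s * real_of_int k .. s * (real_of_int k + 1)}"
  proof
    fix x assume "x \<in> cell s k"
    then have "real_of_int k \<le> x / s" "x / s < real_of_int k + 1"
      unfolding cell_def by (auto simp: floor_eq_iff)
    with assms(1) show "x \<in> {s * real_of_int k .. s * (real_of_int k + 1)}"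
      by (auto simp: field_simps)
  qed
  have "emeasure sample_law (cell s k) = (\<integral>\<^sup>+x. ennreal (f\<^sub>0 x) * indicator (cell s k) x \<partial>lborel)"
    unfolding sample_law_def by (rule emeasure_density) auto
  also have "\<dots> \<le> (\<integral>\<^sup>+x. ennreal B * indicator {s * real_of_int k .. s * (real_of_int k + 1)} x \<partial>lborel)"
    using sub assms by (intro nn_integral_mono mult_mono ennreal_leI) (auto split: split_indicator)
  also have "\<dots> = ennreal B * emeasure lborel {s * real_of_int k .. s * (real_of_int k + 1)}"
    by (rule nn_integral_cmult_indicator) simp
  also have "\<dots> = ennreal (B * s)"
    using assms by (simp add: emeasure_lborel_Icc mult_left_mono ennreal_mult algebra_simps)
  finally show ?thesis
    using assms by (simp add: measure_def enn2real_leI)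
qed

text \<open>The Chernoff bound with \<open>E (exp N) = (1 + (e - 1) * p) ^ n \<le> exp (2 * n * p)\<close>, where \<open>p\<close> is the
  probability of the cell. The expectation is taken of \<open>exp N - 1\<close> rather than of \<open>exp N\<close>: then the
  bound is small for cells of small probability and can be summed over the infinitely many cells.\<close>

lemma cell_count_tail:
  assumes t: "0 < t"
  shows "(exp t - 1) * prob {\<omega> \<in> space P. t \<le> cell_count s k n \<omega>}
    \<le> exp (2 * real n * measure sample_law (cell s k)) - 1"
proof -
  interpret law: prob_space sample_law by (rule prob_space_sample_law)
  let ?A = "{\<omega> \<in> space P. t \<le> cell_count s k n \<omega>}" and ?p = "measure sample_law (cell s k)"
  let ?g = "\<lambda>x. ennreal (exp (indicator (cell s k) x))"
  have A[measurable]: "?A \<in> sets P" by measurable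
  have e: "1 \<le> exp t" "0 \<le> exp t - 1" using t by auto
  have "ennreal ((exp t - 1) * prob ?A + 1) = ennreal (exp t - 1) * emeasure P ?A + 1"
    using e by (simp add: emeasure_eq_measure ennreal_mult ennreal_plus)
  also have "\<dots> = (\<integral>\<^sup>+\<omega>. ennreal (exp t - 1) * indicator ?A \<omega> + 1 \<partial>P)"
    by (subst nn_integral_add) (simp_all add: nn_integral_cmult_indicator emeasure_space_1)
  also have "\<dots> \<le> (\<integral>\<^sup>+\<omega>. (\<Prod>i=1..n. ?g (X i \<omega>)) \<partial>P)"
  proof (rule nn_integral_mono)
    fix \<omega> assume "\<omega> \<in> space P"
    have "(\<Prod>i=1..n. ?g (X i \<omega>)) = ennreal (exp (cell_count s k n \<omega>))"
      by (simp add: prod_ennreal cell_count_def exp_sum)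
    moreover have "ennreal (exp t - 1) * indicator ?A \<omega> + 1 \<le> ennreal (exp (cell_count s k n \<omega>))"
    proof (cases "\<omega> \<in> ?A")
      case True
      then have "ennreal (exp t - 1) * indicator ?A \<omega> + 1 = ennreal (exp t)"
        using e ennreal_plus[of "exp t - 1" 1] by simp
      with True show ?thesis by (auto intro!: ennreal_leI)
    next
      case False
      have "0 \<le> cell_count s k n \<omega>" unfolding cell_count_def by (intro sum_nonneg) auto
      then have "ennreal 1 \<le> ennreal (exp (cell_count s k n \<omega>))" by (intro ennreal_leI) auto
      with False show ?thesis by simp
    qed
    ultimately show "ennreal (exp t - 1) * indicator ?A \<omega> + 1 \<le> (\<Prod>i=1..n. ?g (X i \<omega>))" by simp
  qed
  also have "\<dots> = (\<integral>\<^sup>+x. ennreal (f\<^sub>0 x) * ?g x \<partial>lborel) ^ n"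
    by (rule nn_integral_sample_prod) measurable
  also have "(\<integral>\<^sup>+x. ennreal (f\<^sub>0 x) * ?g x \<partial>lborel) = (\<integral>\<^sup>+x. ?g x \<partial>sample_law)"
    unfolding sample_law_def by (subst nn_integral_density) auto
  also have "\<dots> = (\<integral>\<^sup>+x. 1 + ennreal (exp 1 - 1) * indicator (cell s k) x \<partial>sample_law)"
    using ennreal_plus[of 1 "exp 1 - 1"]
    by (intro nn_integral_cong) (auto split: split_indicator)
  also have "\<dots> = 1 + ennreal (exp 1 - 1) * emeasure sample_law (cell s k)"
    by (subst nn_integral_add) (auto simp: sample_law_def nn_integral_cmult_indicator law.emeasure_space_1[unfolded sample_law_def, simplified])
  also have "\<dots> = ennreal (1 + (exp 1 - 1) * ?p)"
    by (simp add: law.emeasure_eq_measure ennreal_mult ennreal_plus)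
  also have "\<dots> ^ n = ennreal ((1 + (exp 1 - 1) * ?p) ^ n)"
    by (simp add: ennreal_power del: ennreal_plus)
  also have "\<dots> \<le> ennreal (exp (2 * real n * ?p))"
  proof (rule ennreal_leI)
    have "exp (1::real) - 1 \<le> 2" using exp_le by simp
    then have "(exp 1 - 1) * ?p \<le> 2 * ?p" by (intro mult_right_mono) auto
    then have "1 + (exp 1 - 1) * ?p \<le> exp (2 * ?p)"
      using exp_ge_add_one_self[of "2 * ?p"] by linarith
    then have "(1 + (exp 1 - 1) * ?p) ^ n \<le> exp (2 * ?p) ^ n"
      by (intro power_mono) auto
    also have "\<dots> = exp (2 * real n * ?p)"
      by (simp add: exp_of_nat_mult[symmetric] mult_ac)
    finally show "(1 + (exp 1 - 1) * ?p) ^ n \<le> exp (2 * real n * ?p)" .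
  qed
  finally show ?thesis
    by (subst (asm) ennreal_le_iff) auto
qed

text \<open>Since \<open>exp y - 1 \<le> y * exp y\<close>, the bound for one cell is proportional to the probability of the
  cell. These probabilities add up to 1, so a union bound over the whole grid costs only the factor
  \<open>2 * n * exp (2 * n * B * s)\<close>.\<close>

lemma some_cell_count_tail:
  assumes t: "0 < t" and s: "0 < s" and B: "0 \<le> B" "\<And>x. f\<^sub>0 x \<le> B"
  shows "(exp t - 1) * prob (\<Union>k. {\<omega> \<in> space P. t \<le> cell_count s k n \<omega>})
    \<le> 2 * real n * exp (2 * real n * (B * s))"
proof -
  interpret law: prob_space sample_law by (rule prob_space_sample_law)
  let ?A = "\<lambda>k. {\<omega> \<in> space P. t \<le> cell_count s (int_decode k) n \<omega>}"
  let ?p = "\<lambda>k. measure sample_law (cell s (int_decode k))"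
  define D where "D = 2 * real n * exp (2 * real n * (B * s)) / (exp t - 1)"
  have e: "0 < exp t - 1" using t by simp
  have A: "range ?A \<subseteq> events" by auto
  have le: "prob (?A k) \<le> D * ?p k" for k
  proof -
    have "(exp t - 1) * prob (?A k) \<le> exp (2 * real n * ?p k) - 1"
      by (rule cell_count_tail[OF t])
    also have "\<dots> \<le> 2 * real n * ?p k * exp (2 * real n * ?p k)"
      by (rule exp_minus_one_le)
    also have "\<dots> \<le> 2 * real n * ?p k * exp (2 * real n * (B * s))"
      using measure_cell_le[OF s B] by (intro mult_left_mono) (auto intro!: mult_left_mono)
    finally show ?thesis using e by (simp add: D_def field_simps)
  qed
  have "disjoint_family (\<lambda>k. cell s (int_decode k))"
    unfolding disjoint_family_on_def cell_def using inj_eq[OF inj_int_decode] by auto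
  moreover have "range (\<lambda>k. cell s (int_decode k)) \<subseteq> sets sample_law" by (auto simp: sample_law_def)
  ultimately have "?p sums measure sample_law (\<Union>k. cell s (int_decode k))"
    by (intro law.finite_measure_UNION)
  moreover have "(\<Union>k. cell s (int_decode k)) = space sample_law"
    unfolding sample_law_def cell_def by auto (metis int_encode_inverse)
  ultimately have sums: "?p sums 1" by (simp add: law.prob_space)
  have Dsum: "(\<lambda>k. D * ?p k) sums (D * 1)" by (rule sums_mult[OF sums])
  have summ: "summable (\<lambda>k. prob (?A k))"
    by (rule summable_comparison_test'[OF sums_summable[OF Dsum]]) (use le in auto)
  have "(\<Union>k. {\<omega> \<in> space P. t \<le> cell_count s k n \<omega>}) = (\<Union>k. ?A k)"
    by (auto, metis int_encode_inverse)
  then have "prob (\<Union>k. {\<omega> \<in> space P. t \<le> cell_count s k n \<omega>}) \<le> (\<Sum>k. prob (?A k))"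
    using finite_measure_subadditive_countably[OF A summ] by simp
  also have "\<dots> \<le> D"
    using suminf_le[OF le summ sums_summable[OF Dsum]] sums_unique[OF Dsum] by simp
  finally show ?thesis using e by (simp add: D_def field_simps)
qed

text \<open>As the true density is bounded, \<open>n * r\<close> bounds the expected count up to a constant. For
  tiny intervals only the term \<open>ln n\<close> is left, which is much less than the
  fluctuations of order \<open>sqrt n\<close> of an empirical distribution function and is what makes every
  exponent \<open>d < 1\<close> of the sieve admissible. It suffices to treat the scales \<open>1 / j\<close> with
  \<open>j \<le> n\<close>, since for radii below \<open>1 / n\<close> the scale \<open>1 / n\<close> gives a bound of the same form.\<close>

lemma interval_counts:
  "\<exists>C>0. AE \<omega> in P. \<forall>\<^sub>F n in sequentially. \<forall>\<mu> r. 0 < r \<and> r \<le> 1 \<longrightarrow>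
     (\<Sum>i=1..n. indicator {\<mu> - r..\<mu> + r} (X i \<omega>)) \<le> C * (real n * r + 1 + ln (real n))"
proof -
  obtain s where "0 < s" "\<And>m. s \<le> scale (\<theta>\<^sub>0 $ m)"
    using min_scale[OF true_param] by blast
  then have "\<And>x. f\<^sub>0 x \<le> v\<^sub>0 / s" "0 < v\<^sub>0 / s"
    using mixture_le[OF true_param] bounds_pos by auto
  then obtain B where B: "0 < B" "\<And>x. f\<^sub>0 x \<le> B" by blast
  \<comment> \<open>The first term is a bound for the exponent \<open>2 * n * p\<close>; the second one brings the failure probability of each of the \<open>n\<close> scales down to order \<open>n powr -3\<close>.\<close>
  define \<tau> where "\<tau> n j = 2 * real n * (B * (1 / real j)) + 4 * ln (real n)" for n j :: nat
  define bad where "bad n = (\<Union>j\<in>{1..n}. \<Union>k. {\<omega> \<in> space P. \<tau> n j \<le> cell_count (1 / real j) k n \<omega>})" for n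
  have bad_events: "bad n \<in> events" for n
    unfolding bad_def by (intro sets.finite_UN sets.countable_UN') auto
  have bad_prob: "prob (bad n) \<le> 4 / real n ^ 2" if n: "2 \<le> n" for n
  proof -
    have "prob (bad n) \<le> (\<Sum>j=1..n. prob (\<Union>k. {\<omega> \<in> space P. \<tau> n j \<le> cell_count (1 / real j) k n \<omega>}))"
      unfolding bad_def
      by (intro finite_measure_subadditive_finite) (auto intro!: sets.countable_UN')
    also have "\<dots> \<le> (\<Sum>j=1..n. 4 / real n ^ 3)"
    proof (intro sum_mono)
      fix j assume j: "j \<in> {1..n}"
      let ?b = "exp (2 * real n * (B * (1 / real j)))"
      have b: "1 \<le> ?b" using B by simp
      have ln: "0 < ln (real n)" using n by simp
      have \<tau>: "0 < \<tau> n j" unfolding \<tau>_def using B ln by (intro add_nonneg_pos) auto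
      have "exp (4 * ln (real n)) = real n ^ 4"
        using exp_of_nat_mult[of 4 "ln (real n)"] n by simp
      then have exp\<tau>: "exp (\<tau> n j) = ?b * real n ^ 4"
        by (simp add: \<tau>_def exp_add)
      have "2 ^ 4 \<le> real n ^ 4" using n by (intro power_mono) auto
      then have "2 \<le> real n ^ 4" by simp
      then have "1 * 2 \<le> ?b * real n ^ 4" using b by (intro mult_mono) auto
      then have half: "?b * real n ^ 4 / 2 \<le> exp (\<tau> n j) - 1" unfolding exp\<tau> by linarith
      let ?pr = "prob (\<Union>k. {\<omega> \<in> space P. \<tau> n j \<le> cell_count (1 / real j) k n \<omega>})"
      have "?b * real n ^ 4 / 2 * ?pr \<le> (exp (\<tau> n j) - 1) * ?pr"
        using half by (intro mult_right_mono) auto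
      also have "\<dots> \<le> 2 * real n * ?b"
        using j B by (intro some_cell_count_tail[OF \<tau>]) (auto intro: less_imp_le)
      finally have "?b * (real n ^ 4 * ?pr) \<le> ?b * (4 * real n)" by (simp add: mult_ac)
      then have "real n ^ 4 * ?pr \<le> 4 * real n"
        by (subst (asm) mult_le_cancel_left_pos) auto
      then show "?pr \<le> 4 / real n ^ 3"
        using n by (simp add: field_simps power_eq_if)
    qed
    also have "\<dots> = 4 / real n ^ 2" using n by (simp add: field_simps power_eq_if)
    finally show ?thesis .
  qed
  have "summable (\<lambda>n. 4 / real n ^ 2)"
    using summable_mult[OF inverse_power_summable[of 2, where 'a=real], of 4] by (simp add: divide_inverse)
  then have "summable (\<lambda>n. prob (bad n))"
    by (rule summable_comparison_test'[where N=2]) (use bad_prob in auto)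
  then have "AE \<omega> in P. \<forall>\<^sub>F n in sequentially. \<omega> \<in> space P - bad n"
    using bad_events by (intro borel_cantelli_AE1) (auto simp: emeasure_eq_measure)
  then have "AE \<omega> in P. \<forall>\<^sub>F n in sequentially. \<forall>\<mu> r. 0 < r \<and> r \<le> 1 \<longrightarrow>
     (\<Sum>i=1..n. indicator {\<mu> - r..\<mu> + r} (X i \<omega>)) \<le> (12 * B + 12) * (real n * r + 1 + ln (real n))"
  proof eventually_elim
    case (elim \<omega>)
    show ?case
      using elim eventually_ge_at_top[of 1]
    proof (eventually_elim, intro allI impI)
      fix n \<mu> r assume n: "\<omega> \<in> space P - bad n" "1 \<le> n" and r: "0 < r \<and> r \<le> (1::real)"
      \<comment> \<open>the largest admissible \<open>j\<close> with \<open>r \<le> 1 / j\<close>\<close>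
      define j where "j = min n (nat \<lfloor>1 / r\<rfloor>)"
      have fl: "1 \<le> \<lfloor>1 / r\<rfloor>" using r by (simp add: le_floor_iff)
      then have "1 \<le> nat \<lfloor>1 / r\<rfloor>" by linarith
      then have j: "j \<in> {1..n}" using n(2) by (simp add: j_def)
      have "real j \<le> real (nat \<lfloor>1 / r\<rfloor>)" by (simp add: j_def)
      also have real_fl: "\<dots> = real_of_int \<lfloor>1 / r\<rfloor>" using fl by linarith
      also have "\<dots> \<le> 1 / r" by (rule of_int_floor_le)
      finally have r_le: "r \<le> 1 / real j" using r j by (simp add: field_simps)
      have s_le: "1 / real j \<le> 2 * r + 1 / real n"
      proof (cases "n \<le> nat \<lfloor>1 / r\<rfloor>")
        case True
        then show ?thesis using r by (simp add: j_def)
      next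
        case False
        then have "j = nat \<lfloor>1 / r\<rfloor>" by (simp add: j_def)
        then have "real j = real_of_int \<lfloor>1 / r\<rfloor>" using real_fl by simp
        then have "2 * real j \<ge> 1 / r" using fl by linarith
        then have "1 / real j \<le> 2 * r" using r j by (simp add: field_simps)
        then show ?thesis by (simp add: add_increasing2)
      qed
      let ?s = "1 / real j" and ?k = "\<lfloor>\<mu> / (1 / real j)\<rfloor>"
      have "(\<Sum>i=1..n. indicator {\<mu> - r..\<mu> + r} (X i \<omega>))
        \<le> (\<Sum>i=1..n. indicator (cell ?s (?k - 1)) (X i \<omega>) + indicator (cell ?s ?k) (X i \<omega>)
              + indicator (cell ?s (?k + 1)) (X i \<omega>) :: real)"
      proof (rule sum_mono)
        fix i
        show "indicator {\<mu> - r..\<mu> + r} (X i \<omega>) \<le> (indicator (cell ?s (?k - 1)) (X i \<omega>)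
          + indicator (cell ?s ?k) (X i \<omega>) + indicator (cell ?s (?k + 1)) (X i \<omega>) :: real)"
        proof (cases "X i \<omega> \<in> {\<mu> - r..\<mu> + r}")
          case True
          then have "X i \<omega> \<le> \<mu> + 1 / real j" "\<mu> - 1 / real j \<le> X i \<omega>" using r_le by auto
          then have "X i \<omega> / ?s \<le> \<mu> / ?s + 1" "\<mu> / ?s - 1 \<le> X i \<omega> / ?s"
            using j by (auto simp: field_simps)
          then have "\<lfloor>X i \<omega> / ?s\<rfloor> \<in> {?k - 1, ?k, ?k + 1}" by (rule floor_within_one)
          then have "X i \<omega> \<in> cell ?s (?k - 1) \<or> X i \<omega> \<in> cell ?s ?k \<or> X i \<omega> \<in> cell ?s (?k + 1)"
            unfolding cell_def by blast
          then show ?thesis by (rule indicator_le_sum3)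
        qed simp
      qed
      also have "\<dots> = cell_count ?s (?k - 1) n \<omega> + cell_count ?s ?k n \<omega> + cell_count ?s (?k + 1) n \<omega>"
        by (simp add: cell_count_def sum.distrib)
      also have "\<dots> \<le> 3 * \<tau> n j"
      proof -
        have "cell_count ?s k n \<omega> \<le> \<tau> n j" for k
        proof (rule ccontr)
          assume "\<not> cell_count ?s k n \<omega> \<le> \<tau> n j"
          then have "\<omega> \<in> {\<omega> \<in> space P. \<tau> n j \<le> cell_count ?s k n \<omega>}"
            using n(1) by (simp only: mem_Collect_eq not_le less_imp_le Diff_iff)
          then have "\<omega> \<in> bad n" unfolding bad_def by (intro UN_I[OF j] UN_I[OF UNIV_I])
          with n(1) show False by blast
        qed
        from this[of "?k - 1"] this[of ?k] this[of "?k + 1"] show ?thesis by linarith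
      qed
      also have "\<dots> \<le> (12 * B + 12) * (real n * r + 1 + ln (real n))"
      proof -
        have "real n * (1 / real j) \<le> real n * (2 * r + 1 / real n)"
          using s_le by (intro mult_left_mono) auto
        also have "\<dots> = 2 * (real n * r) + 1" using n by (simp add: field_simps)
        finally have "B * (real n * (1 / real j)) \<le> B * (2 * (real n * r) + 1)"
          using B by (intro mult_left_mono) auto
        moreover have "0 \<le> ln (real n)" "0 \<le> real n * r" using n r by auto
        ultimately have "3 * (2 * (B * (real n * (1 / real j))) + 4 * ln (real n))
            \<le> (12 * B + 12) * (real n * r + 1 + ln (real n))"
          using B(1) by (intro count_arithmetic) auto
        moreover have "\<tau> n j = 2 * (B * (real n * (1 / real j))) + 4 * ln (real n)"
          by (simp add: \<tau>_def)
        ultimately show ?thesis by simp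
      qed
      finally show "(\<Sum>i=1..n. indicator {\<mu> - r..\<mu> + r} (X i \<omega>))
          \<le> (12 * B + 12) * (real n * r + 1 + ln (real n))" .
    qed
  qed
  then show ?thesis using B by (intro exI[of _ "12 * B + 12"]) auto
qed

end

section \<open>Components of extreme scale or location\<close>

text \<open>Together with the bounds on the weight this describes a compact set of components. A
  sequence of components without a subsequence that converges to a positive scale leaves each of
  these sets.\<close>

definition moderate :: "real \<Rightarrow> component set" where
  "moderate K = {t. 1 / K \<le> scale t \<and> scale t \<le> K \<and> \<bar>location t\<bar> \<le> K}"

text \<open>Keeping the weights, even of components about to be ignored, makes the result an element of
  \<open>Params\<close>. The regularity assumptions, which concern full mixtures, and the strict bound on the
  affinity, which concerns probability densities, then apply to it.\<close>

definition flatten :: "'m set \<Rightarrow> real \<Rightarrow> 'm::finite param \<Rightarrow> 'm param" where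
  "flatten S R \<theta> = (\<chi> m. if m \<in> S then \<theta> $ m else (weight (\<theta> $ m), 0, R))"

lemma flatten_nth: "flatten S R \<theta> $ m = (if m \<in> S then \<theta> $ m else (weight (\<theta> $ m), 0, R))"
  by (simp add: flatten_def)

lemma flatten_in_Params: "\<theta> \<in> Params \<Longrightarrow> 0 < R \<Longrightarrow> flatten S R \<theta> \<in> Params"
  by (auto simp: Params_def flatten_nth if_distrib[of weight] cong: if_cong)

lemma one_plus_sum_le_prod:
  fixes b :: "'a \<Rightarrow> real"
  assumes "finite A" "\<And>a. a \<in> A \<Longrightarrow> 0 \<le> b a"
  shows "1 + sum b A \<le> (\<Prod>a\<in>A. 1 + b a)"
  using assms
proof (induction A rule: finite_induct)
  case (insert a A)
  have "1 + sum b (insert a A) \<le> (1 + b a) * (1 + sum b A)"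
    using insert sum_nonneg[of A b] by (simp add: algebra_simps)
  also have "\<dots> \<le> (1 + b a) * (\<Prod>a\<in>A. 1 + b a)"
    using insert by (intro mult_left_mono) auto
  finally show ?case using insert by simp
qed simp

context loc_scale_families
begin

text \<open>With \<open>r = \<sigma> powr \<gamma>\<close> the tail bound at distance \<open>r\<close> from the location is \<open>v\<^sub>1 * \<sigma> powr (\<beta> - 1 - \<gamma> * \<beta>)\<close>.
  It vanishes with \<open>\<sigma>\<close> if \<open>\<gamma> < (\<beta> - 1) / \<beta>\<close>; half of this value is taken. All that is needed
  besides is \<open>\<gamma> > 0\<close>.\<close>

definition peak_radius :: "real \<Rightarrow> real" where "peak_radius \<sigma> = \<sigma> powr ((\<beta> - 1) / (2 * \<beta>))"

lemma narrow_component_bound: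
  assumes "0 < \<kappa>"
  shows "\<forall>\<^sub>F \<sigma> in at_right 0. \<forall>m \<mu> x. x \<notin> {\<mu> - peak_radius \<sigma>..\<mu> + peak_radius \<sigma>} \<longrightarrow> loc_scale (\<phi> m) \<mu> \<sigma> x \<le> \<kappa>"
proof -
  have "((\<lambda>\<sigma>. v\<^sub>1 * \<sigma> powr ((\<beta> - 1) / 2)) \<longlongrightarrow> v\<^sub>1 * 0 powr ((\<beta> - 1) / 2)) (at_right 0)"
    using bounds_pos
    by (intro tendsto_intros tendsto_powr2) (auto simp: eventually_at_right_field intro!: exI[of _ 1])
  then have "\<forall>\<^sub>F \<sigma> in at_right 0. v\<^sub>1 * \<sigma> powr ((\<beta> - 1) / 2) < \<kappa>"
    using assms by (intro order_tendstoD(2)) auto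
  with eventually_at_right_less[of "0::real"] show ?thesis
  proof (eventually_elim, intro allI impI)
    fix \<sigma> m \<mu> x assume \<sigma>: "0 < \<sigma>" "v\<^sub>1 * \<sigma> powr ((\<beta> - 1) / 2) < \<kappa>"
      and x: "x \<notin> {\<mu> - peak_radius \<sigma>..\<mu> + peak_radius \<sigma>}"
    have rad: "0 < peak_radius \<sigma>" "peak_radius \<sigma> \<le> \<bar>x - \<mu>\<bar>"
      using \<sigma> x by (auto simp: peak_radius_def)
    then have "loc_scale (\<phi> m) \<mu> \<sigma> x \<le> v\<^sub>1 * \<sigma> powr (\<beta> - 1) * \<bar>x - \<mu>\<bar> powr (-\<beta>)"
      using \<sigma> by (intro loc_scale_le_tail) auto
    also have "\<dots> \<le> v\<^sub>1 * \<sigma> powr (\<beta> - 1) * peak_radius \<sigma> powr (-\<beta>)"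
      using rad bounds_pos by (intro mult_left_mono powr_mono2') auto
    also have "\<dots> = v\<^sub>1 * \<sigma> powr ((\<beta> - 1) + (\<beta> - 1) / (2 * \<beta>) * (-\<beta>))"
      by (simp only: peak_radius_def powr_powr powr_add mult.assoc)
    also have "(\<beta> - 1) + (\<beta> - 1) / (2 * \<beta>) * (-\<beta>) = (\<beta> - 1) / 2"
      using bounds_pos by (simp add: field_simps)
    finally show "loc_scale (\<phi> m) \<mu> \<sigma> x \<le> \<kappa>" using \<sigma>(2) by linarith
  qed
qed

text \<open>Either the scale exceeds \<open>v\<^sub>0 / \<kappa>\<close>, and the height of the density is below \<open>\<kappa>\<close>, or the scale is
  bounded and the location so far away that the tail bound applies on \<open>[-B, B]\<close>.\<close>

lemma diffuse_component_bound:
  assumes "0 < \<kappa>"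
  shows "\<exists>A\<ge>1. \<forall>m \<mu> \<sigma> x. 0 < \<sigma> \<and> \<not> (\<sigma> \<le> A \<and> \<bar>\<mu>\<bar> \<le> A) \<and> \<bar>x\<bar> \<le> B \<longrightarrow> loc_scale (\<phi> m) \<mu> \<sigma> x \<le> \<kappa>"
proof -
  have "((\<lambda>Y. v\<^sub>1 * (v\<^sub>0 / \<kappa>) powr (\<beta> - 1) * Y powr (-\<beta>)) \<longlongrightarrow> v\<^sub>1 * (v\<^sub>0 / \<kappa>) powr (\<beta> - 1) * 0) at_top"
    using bounds_pos by (intro tendsto_mult_left tendsto_neg_powr filterlim_ident) auto
  then have "\<forall>\<^sub>F Y in at_top. v\<^sub>1 * (v\<^sub>0 / \<kappa>) powr (\<beta> - 1) * Y powr (-\<beta>) < \<kappa>"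
    using assms by (intro order_tendstoD(2)) auto
  then have "\<forall>\<^sub>F Y in at_top. v\<^sub>1 * (v\<^sub>0 / \<kappa>) powr (\<beta> - 1) * Y powr (-\<beta>) < \<kappa> \<and> 1 \<le> Y"
    using eventually_ge_at_top[of "1::real"] by (rule eventually_conj)
  from eventually_happens[OF this]
  obtain Y where Y: "v\<^sub>1 * (v\<^sub>0 / \<kappa>) powr (\<beta> - 1) * Y powr (-\<beta>) < \<kappa>" "1 \<le> Y"
    by auto
  define A where "A = max 1 (max (v\<^sub>0 / \<kappa>) (B + Y))"
  have "loc_scale (\<phi> m) \<mu> \<sigma> x \<le> \<kappa>"
    if \<sigma>: "0 < \<sigma>" and far: "\<not> (\<sigma> \<le> A \<and> \<bar>\<mu>\<bar> \<le> A)" and x: "\<bar>x\<bar> \<le> B" for m \<mu> \<sigma> x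
  proof (cases "v\<^sub>0 / \<kappa> \<le> \<sigma>")
    case True
    have "loc_scale (\<phi> m) \<mu> \<sigma> x \<le> v\<^sub>0 / \<sigma>" using \<sigma> by (rule loc_scale_le_height)
    also have "\<dots> \<le> \<kappa>" using True \<sigma> assms by (simp add: field_simps)
    finally show ?thesis .
  next
    case False
    then have "\<bar>\<mu>\<bar> > B + Y" using far by (auto simp: A_def)
    then have Yx: "Y \<le> \<bar>x - \<mu>\<bar>" using x by linarith
    then have "loc_scale (\<phi> m) \<mu> \<sigma> x \<le> v\<^sub>1 * \<sigma> powr (\<beta> - 1) * \<bar>x - \<mu>\<bar> powr (-\<beta>)"
      using \<sigma> Y by (intro loc_scale_le_tail) auto
    also have "\<dots> \<le> v\<^sub>1 * (v\<^sub>0 / \<kappa>) powr (\<beta> - 1) * Y powr (-\<beta>)"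
      using False \<sigma> Yx Y bounds_pos by (intro mult_mono powr_mono2 powr_mono2') auto
    finally show ?thesis using Y by linarith
  qed
  moreover have "1 \<le> A" by (simp add: A_def)
  ultimately show ?thesis by blast
qed

lemma mixture_le_flatten:
  assumes "\<theta> \<in> Params" "0 < R"
  shows "mixture \<phi> \<theta> x \<le> mixture \<phi> (flatten S R \<theta>) x
     + (\<Sum>m\<in>-S. loc_scale (\<phi> m) (location (\<theta> $ m)) (scale (\<theta> $ m)) x)"
proof -
  let ?f = "\<lambda>m. loc_scale (\<phi> m) (location (\<theta> $ m)) (scale (\<theta> $ m)) x"
  let ?g = "\<lambda>m. weight (flatten S R \<theta> $ m) * loc_scale (\<phi> m) (location (flatten S R \<theta> $ m)) (scale (flatten S R \<theta> $ m)) x"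
  have f: "0 \<le> ?f m" "0 \<le> weight (\<theta> $ m)" "weight (\<theta> $ m) \<le> 1" for m
    using assms weight_le_1[OF assms(1), of m] by (auto simp: Params_def loc_scale_nonneg)
  have "mixture \<phi> \<theta> x \<le> (\<Sum>m\<in>UNIV. ?g m + (if m \<in> -S then ?f m else 0))"
    unfolding mixture_def
  proof (rule sum_mono)
    fix m
    have "weight (\<theta> $ m) * ?f m \<le> 1 * ?f m" using f by (intro mult_right_mono)
    moreover have "0 \<le> weight (\<theta> $ m) * loc_scale (\<phi> m) 0 R x"
      using f assms by (intro mult_nonneg_nonneg loc_scale_nonneg)
    ultimately show "weight (\<theta> $ m) * ?f m \<le> ?g m + (if m \<in> -S then ?f m else 0)"
      by (simp add: flatten_nth)
  qed
  also have "\<dots> = (\<Sum>m\<in>UNIV. ?g m) + (\<Sum>m\<in>-S. ?f m)"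
    by (simp only: sum.distrib sum.If_cases[OF finite] Compl_eq[symmetric]) (simp add: Collect_mem_eq Collect_neg_eq sum.If_cases)
  finally show ?thesis by (simp add: mixture_def)
qed

text \<open>The mixture is at most a base \<open>H\<close> plus the peaks of the narrow components. As \<open>H \<ge> \<kappa>\<close>, a sum \<open>H + b\<close>
  is at most \<open>H * (1 + b / \<kappa>)\<close>. The resulting product splits the log-likelihood into that of the base,
  to which the decay of likelihood ratios applies, and a count of observations for each peak.\<close>

lemma mixture_le_peaks:
  assumes \<theta>: "\<theta> \<in> Params" and "0 < R" "0 < \<kappa>" "0 < L"
    and V: "mixture \<phi> (flatten S R \<theta>) x \<le> V" "0 \<le> V"
    and narrow: "\<And>m \<mu> \<sigma>. 0 < \<sigma> \<Longrightarrow> \<sigma> < 1 / L \<Longrightarrow> x \<notin> {\<mu> - peak_radius \<sigma>..\<mu> + peak_radius \<sigma>} \<Longrightarrow>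
        loc_scale (\<phi> m) \<mu> \<sigma> x \<le> \<kappa>"
    and diffuse: "\<And>m \<mu> \<sigma>. 0 < \<sigma> \<Longrightarrow> \<not> (\<sigma> \<le> A \<and> \<bar>\<mu>\<bar> \<le> A) \<Longrightarrow> \<bar>x\<bar> \<le> B \<Longrightarrow>
        loc_scale (\<phi> m) \<mu> \<sigma> x \<le> \<kappa>"
    and out: "\<And>m. m \<notin> S \<Longrightarrow> \<theta> $ m \<notin> moderate (max L A)"
  shows "mixture \<phi> \<theta> x \<le> (V + real CARD('m) * (\<kappa> + (if \<bar>x\<bar> \<le> B then 0 else v\<^sub>0 * L))) *
     (\<Prod>m\<in>UNIV. if scale (\<theta> $ m) < 1 / L then
        exp (indicator {location (\<theta> $ m) - peak_radius (scale (\<theta> $ m))..location (\<theta> $ m) + peak_radius (scale (\<theta> $ m))} x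
          * ln (1 + v\<^sub>0 / \<kappa> / scale (\<theta> $ m))) else 1)"
proof -
  let ?\<mu> = "\<lambda>m. location (\<theta> $ m)" and ?\<sigma> = "\<lambda>m. scale (\<theta> $ m)"
  let ?I = "\<lambda>m. {?\<mu> m - peak_radius (?\<sigma> m)..?\<mu> m + peak_radius (?\<sigma> m)}"
  define e where "e = \<kappa> + (if \<bar>x\<bar> \<le> B then 0 else v\<^sub>0 * L)"
  \<comment> \<open>the peaks: only narrow components, and only near their locations\<close>
  define b where "b m = (if ?\<sigma> m < 1 / L then indicator (?I m) x * (v\<^sub>0 / ?\<sigma> m) else 0)" for m
  define H where "H = V + real CARD('m) * e"
  have \<sigma>: "0 < ?\<sigma> m" for m using \<theta> by (auto simp: Params_def)
  have e: "\<kappa> \<le> e" using assms bounds_pos by (simp add: e_def)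
  have b: "0 \<le> b m" for m using \<sigma>[of m] bounds_pos by (simp add: b_def)
  have comp: "loc_scale (\<phi> m) (?\<mu> m) (?\<sigma> m) x \<le> e + b m" if "m \<notin> S" for m
  proof (cases "?\<sigma> m < 1 / L")
    case True
    show ?thesis
    proof (cases "x \<in> ?I m")
      case in_I: True
      have "loc_scale (\<phi> m) (?\<mu> m) (?\<sigma> m) x \<le> v\<^sub>0 / ?\<sigma> m" using \<sigma> by (rule loc_scale_le_height)
      then show ?thesis using True in_I e \<open>0 < \<kappa>\<close> by (simp add: b_def)
    next
      case False
      then show ?thesis using narrow[OF \<sigma> True False, of m] e b[of m] by linarith
    qed
  next
    case False
    have "1 / max L A \<le> 1 / L" using \<open>0 < L\<close> by (intro divide_left_mono) auto
    then have far: "\<not> (?\<sigma> m \<le> A \<and> \<bar>?\<mu> m\<bar> \<le> A)"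
      using out[OF that] False by (auto simp: moderate_def)
    show ?thesis
    proof (cases "\<bar>x\<bar> \<le> B")
      case True
      then show ?thesis using diffuse[OF \<sigma> far True, of m] e b[of m] by linarith
    next
      case out_B: False
      have "loc_scale (\<phi> m) (?\<mu> m) (?\<sigma> m) x \<le> v\<^sub>0 / ?\<sigma> m" using \<sigma> by (rule loc_scale_le_height)
      also have "\<dots> \<le> v\<^sub>0 / (1 / L)"
        using False \<sigma>[of m] \<open>0 < L\<close> bounds_pos by (intro divide_left_mono) auto
      finally show ?thesis using out_B b[of m] \<open>0 < \<kappa>\<close> by (simp add: e_def)
    qed
  qed
  have "mixture \<phi> \<theta> x \<le> V + (\<Sum>m\<in>-S. loc_scale (\<phi> m) (?\<mu> m) (?\<sigma> m) x)"
    using mixture_le_flatten[OF \<theta> \<open>0 < R\<close>, of x S] V(1) by linarith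
  also have "(\<Sum>m\<in>-S. loc_scale (\<phi> m) (?\<mu> m) (?\<sigma> m) x) \<le> (\<Sum>m\<in>-S. e + b m)"
    using comp by (intro sum_mono) auto
  also have "\<dots> \<le> (\<Sum>m\<in>UNIV. e + b m)"
    using e b \<open>0 < \<kappa>\<close> by (intro sum_mono2) (auto intro!: add_nonneg_nonneg)
  also have "V + \<dots> = H + (\<Sum>m\<in>UNIV. b m)"
    by (simp add: sum.distrib H_def)
  also have "\<dots> \<le> H * (1 + (\<Sum>m\<in>UNIV. b m / \<kappa>))"
  proof -
    have "1 * \<kappa> \<le> real CARD('m) * e"
      using e \<open>0 < \<kappa>\<close> by (intro mult_mono) (auto simp: Suc_le_eq)
    then have "\<kappa> \<le> H" using V(2) by (simp add: H_def)
    then have "\<kappa> * (\<Sum>m\<in>UNIV. b m / \<kappa>) \<le> H * (\<Sum>m\<in>UNIV. b m / \<kappa>)"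
      using b \<open>0 < \<kappa>\<close> by (intro mult_right_mono sum_nonneg) auto
    moreover have "\<kappa> * (\<Sum>m\<in>UNIV. b m / \<kappa>) = (\<Sum>m\<in>UNIV. b m)"
      using \<open>0 < \<kappa>\<close> by (simp add: sum_distrib_left)
    ultimately show ?thesis by (simp add: algebra_simps)
  qed
  also have "\<dots> \<le> H * (\<Prod>m\<in>UNIV. 1 + b m / \<kappa>)"
    using b \<open>0 < \<kappa>\<close> V(2) e unfolding H_def
    by (intro mult_left_mono one_plus_sum_le_prod) auto
  also have "(\<Prod>m\<in>UNIV. 1 + b m / \<kappa>) = (\<Prod>m\<in>UNIV. if ?\<sigma> m < 1 / L then
        exp (indicator (?I m) x * ln (1 + v\<^sub>0 / \<kappa> / ?\<sigma> m)) else 1)"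
  proof (rule prod.cong)
    fix m
    have "0 < 1 + v\<^sub>0 / \<kappa> / ?\<sigma> m"
      using \<sigma>[of m] \<open>0 < \<kappa>\<close> bounds_pos by (intro add_pos_pos) auto
    then show "1 + b m / \<kappa> = (if ?\<sigma> m < 1 / L then exp (indicator (?I m) x * ln (1 + v\<^sub>0 / \<kappa> / ?\<sigma> m)) else 1)"
      by (auto simp: b_def mult_ac split: split_indicator)
  qed simp
  finally show ?thesis by (simp only: H_def e_def)
qed

end

section \<open>Domination near a wrong parameter\<close>

locale mixture_sieve = mixture_sample \<phi> v\<^sub>0 v\<^sub>1 \<beta> P \<theta>\<^sub>0 X
  for \<phi> :: "'m::finite \<Rightarrow> real \<Rightarrow> real" and v\<^sub>0 v\<^sub>1 \<beta> :: real and P :: "'w measure"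
    and \<theta>\<^sub>0 :: "'m param" and X :: "nat \<Rightarrow> 'w \<Rightarrow> real" +
  fixes c\<^sub>0 d :: real and c :: "nat \<Rightarrow> real"
  assumes rate: "0 < c\<^sub>0" "0 < d" "d < 1"
    and scale_bound: "\<And>n. c n = c\<^sub>0 * exp (- (real n powr d))"
begin

lemma sieve_pos: "0 < c n"
  using rate by (simp add: scale_bound)

text \<open>The count has a part proportional to the radius and a part of order \<open>1 + ln n\<close>. The first is
  beaten by choosing \<open>s\<close> small, since \<open>\<sigma> powr \<gamma> * ln (1 + K / \<sigma>)\<close> tends to 0 with \<open>\<sigma>\<close>. For the second the
  logarithm is largest at \<open>\<sigma> = c n\<close>, where it is of order \<open>n powr d\<close> with \<open>d < 1\<close>.\<close>

lemma narrow_peaks_negligible: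
  assumes "0 < K" "0 < \<delta>"
  shows "\<exists>s>0. AE \<omega> in P. \<forall>\<^sub>F n in sequentially. \<forall>\<mu> \<sigma>. c n \<le> \<sigma> \<and> \<sigma> < s \<longrightarrow>
     (\<Sum>i=1..n. indicator {\<mu> - peak_radius \<sigma>..\<mu> + peak_radius \<sigma>} (X i \<omega>)) * ln (1 + K / \<sigma>) \<le> \<delta> * real n"
proof -
  define \<gamma> where "\<gamma> = (\<beta> - 1) / (2 * \<beta>)"
  have \<gamma>: "0 < \<gamma>" using bounds_pos by (simp add: \<gamma>_def)
  obtain C where C: "0 < C" and count: "AE \<omega> in P. \<forall>\<^sub>F n in sequentially. \<forall>\<mu> r. 0 < r \<and> r \<le> 1 \<longrightarrow>
     (\<Sum>i=1..n. indicator {\<mu> - r..\<mu> + r} (X i \<omega>)) \<le> C * (real n * r + 1 + ln (real n))"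
    using interval_counts by blast
  have "((\<lambda>\<sigma>. C * \<sigma> powr \<gamma> * ln (1 + K / \<sigma>)) \<longlongrightarrow> 0) (at_right 0)"
    using \<gamma> C assms by real_asymp
  then have "\<forall>\<^sub>F \<sigma> in at_right 0. C * \<sigma> powr \<gamma> * ln (1 + K / \<sigma>) < \<delta> / 2"
    using assms by (intro order_tendstoD(2)) auto
  then obtain b where b: "0 < b" "\<And>\<sigma>. 0 < \<sigma> \<Longrightarrow> \<sigma> < b \<Longrightarrow> C * \<sigma> powr \<gamma> * ln (1 + K / \<sigma>) < \<delta> / 2"
    unfolding eventually_at_right_field by auto
  have "((\<lambda>n. C * (1 + ln (real n)) * ln (1 + K / c n) / real n) \<longlongrightarrow> 0) sequentially"
    unfolding scale_bound using rate assms C by real_asymp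
  then have "\<forall>\<^sub>F n in sequentially. C * (1 + ln (real n)) * ln (1 + K / c n) / real n < \<delta> / 2"
    using assms by (intro order_tendstoD(2)) auto
  then have ev: "\<forall>\<^sub>F n in sequentially. 1 \<le> n \<and> C * (1 + ln (real n)) * ln (1 + K / c n) / real n < \<delta> / 2"
    using eventually_ge_at_top[of 1] by eventually_elim auto
  have "AE \<omega> in P. \<forall>\<^sub>F n in sequentially. \<forall>\<mu> \<sigma>. c n \<le> \<sigma> \<and> \<sigma> < min 1 b \<longrightarrow>
     (\<Sum>i=1..n. indicator {\<mu> - peak_radius \<sigma>..\<mu> + peak_radius \<sigma>} (X i \<omega>)) * ln (1 + K / \<sigma>) \<le> \<delta> * real n"
    using count
  proof eventually_elim
    case (elim \<omega>)
    show ?case using elim ev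
    proof (eventually_elim, intro allI impI)
      fix n \<mu> \<sigma>
      assume count: "\<forall>\<mu> r. 0 < r \<and> r \<le> 1 \<longrightarrow>
          (\<Sum>i=1..n. indicator {\<mu> - r..\<mu> + r} (X i \<omega>)) \<le> C * (real n * r + 1 + ln (real n))"
        and n: "1 \<le> n \<and> C * (1 + ln (real n)) * ln (1 + K / c n) / real n < \<delta> / 2"
        and \<sigma>: "c n \<le> \<sigma> \<and> \<sigma> < min 1 b"
      have \<sigma>0: "0 < \<sigma>" using \<sigma> sieve_pos[of n] by linarith
      have ln: "0 \<le> ln (1 + K / \<sigma>)" "ln (1 + K / \<sigma>) \<le> ln (1 + K / c n)"
      proof -
        have "K / \<sigma> \<le> K / c n" using \<sigma> \<sigma>0 assms sieve_pos[of n] by (intro divide_left_mono) auto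
        moreover have "0 < K / \<sigma>" using assms \<sigma>0 by simp
        ultimately show "0 \<le> ln (1 + K / \<sigma>)" "ln (1 + K / \<sigma>) \<le> ln (1 + K / c n)" by auto
      qed
      have rad: "0 < peak_radius \<sigma>" "peak_radius \<sigma> \<le> 1"
        using \<sigma> \<sigma>0 \<gamma> by (auto simp: peak_radius_def \<gamma>_def[symmetric] powr_le1)
      have "(\<Sum>i=1..n. indicator {\<mu> - peak_radius \<sigma>..\<mu> + peak_radius \<sigma>} (X i \<omega>)) * ln (1 + K / \<sigma>)
          \<le> C * (real n * peak_radius \<sigma> + 1 + ln (real n)) * ln (1 + K / \<sigma>)"
        using count rad ln by (intro mult_right_mono) auto
      also have "\<dots> = real n * (C * \<sigma> powr \<gamma> * ln (1 + K / \<sigma>)) + C * (1 + ln (real n)) * ln (1 + K / \<sigma>)"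
        by (simp add: peak_radius_def \<gamma>_def algebra_simps)
      also have "\<dots> \<le> real n * (\<delta> / 2) + real n * (\<delta> / 2)"
      proof (rule add_mono)
        show "real n * (C * \<sigma> powr \<gamma> * ln (1 + K / \<sigma>)) \<le> real n * (\<delta> / 2)"
          using b(2)[of \<sigma>] \<sigma> \<sigma>0 by (intro mult_left_mono) auto
        have "C * (1 + ln (real n)) * ln (1 + K / \<sigma>) \<le> C * (1 + ln (real n)) * ln (1 + K / c n)"
          using ln C n by (intro mult_left_mono) auto
        also have "\<dots> \<le> real n * (\<delta> / 2)"
        proof -
          have "0 < real n" using n by simp
          from conjunct2[OF n, unfolded pos_divide_less_eq[OF this]]
          show ?thesis by (simp only: mult.commute[of "real n"] less_imp_le)
        qed
        finally show "C * (1 + ln (real n)) * ln (1 + K / \<sigma>) \<le> real n * (\<delta> / 2)" .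
      qed
      finally show "(\<Sum>i=1..n. indicator {\<mu> - peak_radius \<sigma>..\<mu> + peak_radius \<sigma>} (X i \<omega>)) * ln (1 + K / \<sigma>) \<le> \<delta> * real n"
        by (simp add: algebra_simps)
    qed
  qed
  with b(1) show ?thesis by (intro exI[of _ "min 1 b"]) auto
qed

text \<open>The constants depend on each other in this order. An envelope \<open>V k\<close> over a small ball and
  \<open>\<kappa>\<close> are chosen such that the affinity of \<open>V k + M * \<kappa>\<close> is below 1, and \<open>\<delta>\<close> measures the gap. Given \<open>\<kappa>\<close>
  and \<open>\<delta>\<close>, scales below \<open>1 / L\<close> are so small that the peaks cost at most \<open>\<delta> * n\<close> altogether. Components
  that are not narrow are bounded by \<open>v\<^sub>0 * L\<close>, and this bound is used outside of \<open>[-j, j]\<close>, with \<open>j\<close> so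
  large that the affinity hardly changes. Finally \<open>A\<close> makes the diffuse components smaller than \<open>\<kappa>\<close> on
  \<open>[-j, j]\<close>. The radius and \<open>K\<close> depend neither on \<open>S\<close> nor on \<open>R\<close>, so that one null set serves all of
  them.\<close>

lemma local_domination:
  assumes \<theta>: "\<theta> \<in> Params" and neq: "\<not> (AE x in lborel. mixture \<phi> \<theta> x = f\<^sub>0 x)"
  shows "\<exists>\<rho>>0. \<exists>K>0. AE \<omega> in P. \<forall>\<^sub>F n in sequentially. \<forall>S R. \<forall>\<eta>\<in>restricted_params (c n).
    0 < R \<longrightarrow> dist (flatten S R \<eta>) \<theta> < \<rho> \<longrightarrow> (\<forall>m. m \<notin> S \<longrightarrow> \<eta> $ m \<notin> moderate K) \<longrightarrow>
    (\<Prod>i=1..n. mixture \<phi> \<eta> (X i \<omega>)) < (\<Prod>i=1..n. f\<^sub>0 (X i \<omega>))"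
proof -
  define M where "M = real CARD('m)"
  have M: "1 \<le> M" by (simp add: M_def Suc_le_eq)
  \<comment> \<open>any positive \<open>t < 1 - 1 / \<beta>\<close> satisfies \<open>\<beta> * (1 - t) > 1\<close>\<close>
  define t where "t = (1 - 1 / \<beta>) / 2"
  have t: "0 < t" "t < 1" "1 < \<beta> * (1 - t)"
    using bounds_pos by (auto simp: t_def field_simps)
  let ?J = "\<lambda>H. \<integral>\<^sup>+x. ennreal (H x powr t * f\<^sub>0 x powr (1 - t)) \<partial>lborel"
  obtain \<rho> :: "nat \<Rightarrow> real" and V :: "nat \<Rightarrow> real \<Rightarrow> real" and C where env:
    "\<And>k. 0 < \<rho> k" "\<And>k. V k \<in> borel_measurable borel"
    "\<And>k x. 0 \<le> V k x" "\<And>k x. V k x \<le> C"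
    "\<And>k. AE x in lborel. \<forall>\<theta>'\<in>Params. dist \<theta>' \<theta> \<le> \<rho> k \<longrightarrow> mixture \<phi> \<theta>' x \<le> V k x"
    "AE x in lborel. (\<lambda>k. V k x) \<longlonglongrightarrow> mixture \<phi> \<theta> x"
    using measurable_envelope[OF \<theta>] by blast
  note [measurable] = env(2)
  have "(\<lambda>k. ?J (\<lambda>x. V k x + M * (1 / (real k + 1)))) \<longlonglongrightarrow> ?J (mixture \<phi> \<theta>)"
  proof (rule affinity_tendsto[OF true_param t(1,3), where C="C + M * 1"])
    show "V k x + M * (1 / (real k + 1)) \<le> C + M * 1" for k x
      using M env(4)[of k x] by (intro add_mono mult_left_mono) auto
    show "AE x in lborel. (\<lambda>k. V k x + M * (1 / (real k + 1))) \<longlonglongrightarrow> mixture \<phi> \<theta> x"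
      using env(6)
    proof eventually_elim
      case (elim x)
      have "(\<lambda>k. M * (1 / (real k + 1))) \<longlonglongrightarrow> 0" by real_asymp
      from tendsto_add[OF elim this] show ?case by simp
    qed
  qed (use M env(3) in auto)
  moreover have "?J (mixture \<phi> \<theta>) < 1"
    using \<theta> true_param t neq
    by (intro affinity_less_one) (auto simp: mixture_nonneg nn_integral_mixture)
  ultimately have "\<forall>\<^sub>F k in sequentially. ?J (\<lambda>x. V k x + M * (1 / (real k + 1))) < 1"
    by (rule order_tendstoD)
  then obtain k where k: "?J (\<lambda>x. V k x + M * (1 / (real k + 1))) < 1"
    by (auto dest: eventually_happens)
  define \<kappa> where "\<kappa> = 1 / (real k + 1)"
  have \<kappa>: "0 < \<kappa>" "?J (\<lambda>x. V k x + M * \<kappa>) < 1" using k by (auto simp: \<kappa>_def)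
  have "((\<lambda>\<delta>. ennreal (exp (- t * \<delta>))) \<longlongrightarrow> ennreal (exp (- t * 0))) (at_right 0)"
    by (intro tendsto_intros)
  then have "\<forall>\<^sub>F \<delta> in at_right 0. ?J (\<lambda>x. V k x + M * \<kappa>) < ennreal (exp (- t * \<delta>))"
    using \<kappa>(2) by (intro order_tendstoD(1)) auto
  then obtain \<delta> where \<delta>: "0 < \<delta>" "?J (\<lambda>x. V k x + M * \<kappa>) < ennreal (exp (- t * \<delta>))"
    unfolding eventually_at_right_field by (metis dense)
  have K: "0 < v\<^sub>0 / \<kappa>" "0 < \<delta> / M" using \<kappa> \<delta> bounds_pos M by auto
  obtain s where s: "0 < s" and peaks: "AE \<omega> in P. \<forall>\<^sub>F n in sequentially. \<forall>\<mu> \<sigma>. c n \<le> \<sigma> \<and> \<sigma> < s \<longrightarrow>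
     (\<Sum>i=1..n. indicator {\<mu> - peak_radius \<sigma>..\<mu> + peak_radius \<sigma>} (X i \<omega>)) * ln (1 + v\<^sub>0 / \<kappa> / \<sigma>) \<le> \<delta> / M * real n"
    using narrow_peaks_negligible[OF K] by blast
  obtain b where b: "0 < b" "\<And>\<sigma> m \<mu> x. 0 < \<sigma> \<Longrightarrow> \<sigma> < b \<Longrightarrow>
      x \<notin> {\<mu> - peak_radius \<sigma>..\<mu> + peak_radius \<sigma>} \<Longrightarrow> loc_scale (\<phi> m) \<mu> \<sigma> x \<le> \<kappa>"
    using narrow_component_bound[OF \<kappa>(1)] unfolding eventually_at_right_field by blast
  define L where "L = 1 / min s b"
  have L: "0 < L" "1 / L \<le> s" "1 / L \<le> b" using s b(1) by (auto simp: L_def)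
  \<comment> \<open>the base of the comparison: on \<open>[-B, B]\<close> all escaping components are below \<open>\<kappa>\<close> off their peaks\<close>
  let ?H = "\<lambda>B x. V k x + M * (\<kappa> + (if \<bar>x\<bar> \<le> B then 0 else v\<^sub>0 * L))"
  have H_meas: "?H B \<in> borel_measurable borel" for B
  proof -
    have "?H B = (\<lambda>x. V k x + M * (\<kappa> + v\<^sub>0 * L * indicator (- {-B..B}) x))"
      by (rule ext) (auto simp: indicator_def abs_le_iff)
    then show ?thesis by simp
  qed
  have "(\<lambda>j. ?J (?H (real j))) \<longlonglongrightarrow> ?J (\<lambda>x. V k x + M * \<kappa>)"
  proof (rule affinity_tendsto[OF true_param t(1,3), where C="C + M * (\<kappa> + v\<^sub>0 * L)"])
    show "?H (real j) x \<le> C + M * (\<kappa> + v\<^sub>0 * L)" for j x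
      using M env(4)[of k x] bounds_pos L(1) by (intro add_mono mult_left_mono) auto
    show "0 \<le> ?H (real j) x" for j x
      using M env(3)[of k x] bounds_pos L(1) \<kappa>(1) by (intro add_nonneg_nonneg mult_nonneg_nonneg) auto
    show "AE x in lborel. (\<lambda>j. ?H (real j) x) \<longlonglongrightarrow> V k x + M * \<kappa>"
    proof (rule AE_I2, rule tendsto_eventually)
      fix x
      show "\<forall>\<^sub>F j in sequentially. ?H (real j) x = V k x + M * \<kappa>"
        using eventually_ge_at_top[of "nat \<lceil>\<bar>x\<bar>\<rceil>"]
        by eventually_elim (auto simp: nat_ceiling_le_eq)
    qed
    show "?H (real j) \<in> borel_measurable borel" for j by (rule H_meas)
  qed measurable
  from order_tendstoD(2)[OF this \<delta>(2)]
  obtain j where j: "?J (?H (real j)) < ennreal (exp (- t * \<delta>))"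
    by (auto dest: eventually_happens)
  let ?B = "real j"
  obtain A where A: "1 \<le> A" "\<And>m \<mu> \<sigma> x. 0 < \<sigma> \<Longrightarrow> \<not> (\<sigma> \<le> A \<and> \<bar>\<mu>\<bar> \<le> A) \<Longrightarrow> \<bar>x\<bar> \<le> ?B \<Longrightarrow>
      loc_scale (\<phi> m) \<mu> \<sigma> x \<le> \<kappa>"
    using diffuse_component_bound[OF \<kappa>(1), of ?B] by blast
  have decay: "AE \<omega> in P. \<forall>\<^sub>F n in sequentially.
      (\<Prod>i=1..n. ?H ?B (X i \<omega>)) < exp (- \<delta> * real n) * (\<Prod>i=1..n. f\<^sub>0 (X i \<omega>))"
  proof (rule likelihood_ratio_decay[OF H_meas _ t(1) j])
    show "0 \<le> ?H ?B x" for x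
      using M env(3)[of k x] bounds_pos L(1) \<kappa>(1) by (intro add_nonneg_nonneg mult_nonneg_nonneg) auto
  qed
  have envelope: "AE \<omega> in P. \<forall>i\<ge>1. \<forall>\<theta>'\<in>Params. dist \<theta>' \<theta> \<le> \<rho> k \<longrightarrow> mixture \<phi> \<theta>' (X i \<omega>) \<le> V k (X i \<omega>)"
    by (rule AE_sample) (use env(5)[of k] in auto)
  have "AE \<omega> in P. \<forall>\<^sub>F n in sequentially. \<forall>S R. \<forall>\<eta>\<in>restricted_params (c n).
    0 < R \<longrightarrow> dist (flatten S R \<eta>) \<theta> < \<rho> k \<longrightarrow> (\<forall>m. m \<notin> S \<longrightarrow> \<eta> $ m \<notin> moderate (max L A)) \<longrightarrow>
    (\<Prod>i=1..n. mixture \<phi> \<eta> (X i \<omega>)) < (\<Prod>i=1..n. f\<^sub>0 (X i \<omega>))"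
    using decay envelope peaks
  proof eventually_elim
    case (elim \<omega>)
    show ?case using elim(1,3)
    proof (eventually_elim, intro allI ballI impI)
      fix n S R \<eta>
      assume decay: "(\<Prod>i=1..n. ?H ?B (X i \<omega>)) < exp (- \<delta> * real n) * (\<Prod>i=1..n. f\<^sub>0 (X i \<omega>))"
        and peaks: "\<forall>\<mu> \<sigma>. c n \<le> \<sigma> \<and> \<sigma> < s \<longrightarrow>
          (\<Sum>i=1..n. indicator {\<mu> - peak_radius \<sigma>..\<mu> + peak_radius \<sigma>} (X i \<omega>)) * ln (1 + v\<^sub>0 / \<kappa> / \<sigma>) \<le> \<delta> / M * real n"
        and \<eta>: "\<eta> \<in> restricted_params (c n)" and R: "0 < R"
        and close: "dist (flatten S R \<eta>) \<theta> < \<rho> k" and out: "\<forall>m. m \<notin> S \<longrightarrow> \<eta> $ m \<notin> moderate (max L A)"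
      have \<eta>P: "\<eta> \<in> Params" and \<sigma>: "\<And>m. c n \<le> scale (\<eta> $ m)"
        using \<eta> by (auto simp: restricted_params_def)
      let ?I = "\<lambda>m. {location (\<eta> $ m) - peak_radius (scale (\<eta> $ m))..location (\<eta> $ m) + peak_radius (scale (\<eta> $ m))}"
      let ?l = "\<lambda>m. ln (1 + v\<^sub>0 / \<kappa> / scale (\<eta> $ m))"
      let ?G = "\<lambda>m x. if scale (\<eta> $ m) < 1 / L then exp (indicator (?I m) x * ?l m) else 1"
      have "mixture \<phi> \<eta> (X i \<omega>) \<le> ?H ?B (X i \<omega>) * (\<Prod>m\<in>UNIV. ?G m (X i \<omega>))" if i: "i \<in> {1..n}" for i
        unfolding M_def
      proof (rule mixture_le_peaks[OF \<eta>P R \<kappa>(1) L(1), where S=S and A=A])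
        show "mixture \<phi> (flatten S R \<eta>) (X i \<omega>) \<le> V k (X i \<omega>)"
          using elim(2) i close flatten_in_Params[OF \<eta>P R] by auto
        show "loc_scale (\<phi> m) \<mu> \<sigma> (X i \<omega>) \<le> \<kappa>"
          if "0 < \<sigma>" "\<sigma> < 1 / L" "X i \<omega> \<notin> {\<mu> - peak_radius \<sigma>..\<mu> + peak_radius \<sigma>}" for m \<mu> \<sigma>
          using that L(3) by (intro b(2)) auto
      qed (use env(3) A out in auto)
      then have "(\<Prod>i=1..n. mixture \<phi> \<eta> (X i \<omega>)) \<le> (\<Prod>i=1..n. ?H ?B (X i \<omega>) * (\<Prod>m\<in>UNIV. ?G m (X i \<omega>)))"
        using mixture_nonneg[OF \<eta>P] by (intro prod_mono) auto
      also have "\<dots> = (\<Prod>i=1..n. ?H ?B (X i \<omega>)) * (\<Prod>m\<in>UNIV. \<Prod>i=1..n. ?G m (X i \<omega>))"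
        by (simp only: prod.distrib) (subst prod.swap, rule refl)
      also have "\<dots> \<le> (\<Prod>i=1..n. ?H ?B (X i \<omega>)) * (\<Prod>m\<in>(UNIV::'m set). exp (\<delta> / M * real n))"
      proof (intro mult_left_mono prod_mono prod_nonneg conjI)
        fix m
        show "(\<Prod>i=1..n. ?G m (X i \<omega>)) \<le> exp (\<delta> / M * real n)"
        proof (cases "scale (\<eta> $ m) < 1 / L")
          case True
          then have "(\<Prod>i=1..n. ?G m (X i \<omega>)) = exp ((\<Sum>i=1..n. indicator (?I m) (X i \<omega>)) * ?l m)"
            by (simp only: if_True sum_distrib_right exp_sum[OF finite_atLeastAtMost])
          also have "\<dots> \<le> exp (\<delta> / M * real n)"
            unfolding exp_le_cancel_iff
            by (rule peaks[rule_format]) (use \<sigma>[of m] True L(2) in simp)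
          finally show ?thesis .
        next
          case False
          then show ?thesis using \<delta> M by simp
        qed
      next
        show "0 \<le> ?H ?B (X i \<omega>)" for i
          using M env(3)[of k "X i \<omega>"] bounds_pos L(1) \<kappa>(1) by (intro add_nonneg_nonneg mult_nonneg_nonneg) auto
      qed auto
      also have "(\<Prod>m\<in>(UNIV::'m set). exp (\<delta> / M * real n)) = exp (\<delta> * real n)"
      proof -
        have "(\<Prod>m\<in>(UNIV::'m set). exp (\<delta> / M * real n)) = exp (M * (\<delta> / M * real n))"
          by (simp only: prod_constant M_def exp_of_nat_mult)
        then show ?thesis using M by simp
      qed
      also have "(\<Prod>i=1..n. ?H ?B (X i \<omega>)) * \<dots>
          < exp (- \<delta> * real n) * (\<Prod>i=1..n. f\<^sub>0 (X i \<omega>)) * exp (\<delta> * real n)"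
        using decay by (intro mult_strict_right_mono) auto
      also have "\<dots> = (\<Prod>i=1..n. f\<^sub>0 (X i \<omega>))"
        by (simp add: mult_ac exp_minus)
      finally show "(\<Prod>i=1..n. mixture \<phi> \<eta> (X i \<omega>)) < (\<Prod>i=1..n. f\<^sub>0 (X i \<omega>))" .
    qed
  qed
  moreover have "0 < max L A" using L(1) by simp
  ultimately show ?thesis using env(1)[of k] by blast
qed

end

section \<open>Compactness of the parameter set\<close>

text \<open>A limit with scale 0 does not count as convergence; such a sequence leaves every moderate set.\<close>

definition settles :: "(nat \<Rightarrow> component) \<Rightarrow> bool" where
  "settles t \<longleftrightarrow> (\<exists>a. (\<lambda>j. weight (t j)) \<longlonglongrightarrow> a) \<and>
     ((\<exists>\<tau>. 0 < scale \<tau> \<and> t \<longlonglongrightarrow> \<tau>) \<or> (\<forall>K. \<forall>\<^sub>F j in sequentially. t j \<notin> moderate K))"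

lemma settles_subseq:
  assumes "settles t" "strict_mono r"
  shows "settles (\<lambda>j. t (r j))"
proof -
  have sub: "(\<lambda>j. f (r j)) \<longlonglongrightarrow> l" if "f \<longlonglongrightarrow> l" for f :: "nat \<Rightarrow> 'a::topological_space" and l
    using LIMSEQ_subseq_LIMSEQ[OF that assms(2)] by (simp add: comp_def)
  obtain a where a: "(\<lambda>j. weight (t j)) \<longlonglongrightarrow> a"
    using assms(1) by (auto simp: settles_def)
  from assms(1) consider \<tau> where "0 < scale \<tau>" "t \<longlonglongrightarrow> \<tau>"
    | "\<And>K. \<forall>\<^sub>F j in sequentially. t j \<notin> moderate K"
    by (auto simp: settles_def)
  then show ?thesis
  proof cases
    case 1
    with sub[OF a] sub[OF 1(2)] show ?thesis unfolding settles_def by blast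
  next
    case 2
    with sub[OF a] show ?thesis unfolding settles_def by (auto intro: eventually_subseq[OF assms(2)])
  qed
qed

text \<open>If some moderate set is visited infinitely often, compactness gives a limit of positive scale;
  otherwise the whole sequence escapes and only the weights need a convergent subsequence.\<close>

lemma settling_subsequence:
  fixes t :: "nat \<Rightarrow> component"
  assumes t: "\<And>j. 0 \<le> weight (t j)" "\<And>j. weight (t j) \<le> 1" "\<And>j. 0 < scale (t j)"
  shows "\<exists>r. strict_mono r \<and> settles (\<lambda>j. t (r j))"
proof (cases "\<exists>K. \<exists>\<^sub>F j in sequentially. t j \<in> moderate K")
  case True
  then obtain K where K: "\<exists>\<^sub>F j in sequentially. t j \<in> moderate K" by blast
  then have inf: "infinite {j. t j \<in> moderate K}"
    by (simp add: cofinite_eq_sequentially[symmetric] frequently_cofinite)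
  define r where "r = enumerate {j. t j \<in> moderate K}"
  have r: "strict_mono r" "\<And>j. t (r j) \<in> moderate K"
    using strict_mono_enumerate[OF inf] enumerate_in_set[OF inf] by (auto simp: r_def)
  have "0 < K"
    using r(2)[of 0] t(3)[of "r 0"] by (auto simp: moderate_def)
  let ?C = "{0..1::real} \<times> {-K..K} \<times> {1 / K..K}"
  have "compact ?C" by (intro compact_Times compact_Icc)
  moreover have "\<forall>j. t (r j) \<in> ?C"
    using r(2) t by (auto simp: moderate_def mem_Times_iff abs_le_iff minus_le_iff)
  ultimately obtain l r' where l: "l \<in> ?C" "strict_mono (r' :: nat \<Rightarrow> nat)" "((\<lambda>j. t (r j)) \<circ> r') \<longlonglongrightarrow> l"
    unfolding compact_def by meson
  have "0 < 1 / K" using \<open>0 < K\<close> by simp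
  moreover have "1 / K \<le> scale l" using l(1) by (auto simp: mem_Times_iff)
  ultimately have "0 < scale l" by (rule less_le_trans)
  moreover have "(\<lambda>j. weight (t (r (r' j)))) \<longlonglongrightarrow> weight l"
    using tendsto_fst[OF l(3)] by (simp add: comp_def)
  ultimately have "settles (\<lambda>j. t ((r \<circ> r') j))"
    using l(3) unfolding settles_def comp_def by blast
  then show ?thesis using strict_mono_o[OF r(1) l(2)] by blast
next
  case False
  have "compact {0..1::real}" by (rule compact_Icc)
  moreover have "\<forall>j. weight (t j) \<in> {0..1}" using t by simp
  ultimately obtain l r where r: "strict_mono (r :: nat \<Rightarrow> nat)" "((\<lambda>j. weight (t j)) \<circ> r) \<longlonglongrightarrow> l"
    unfolding compact_def by meson
  have "\<forall>K. \<forall>\<^sub>F j in sequentially. t (r j) \<notin> moderate K"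
    using False eventually_subseq[OF r(1)] by (auto simp: not_frequently)
  then show ?thesis using r by (auto simp: settles_def comp_def)
qed

lemma settling_subsequence_all:
  fixes \<zeta> :: "nat \<Rightarrow> 'm::finite param"
  assumes \<zeta>: "\<And>j. \<zeta> j \<in> Params"
  shows "\<exists>r. strict_mono r \<and> (\<forall>m. settles (\<lambda>j. \<zeta> (r j) $ m))"
proof -
  have "\<exists>r. strict_mono r \<and> (\<forall>m\<in>A. settles (\<lambda>j. \<zeta> (r j) $ m))" if "finite A" for A
    using that
  proof (induction A rule: finite_induct)
    case empty
    show ?case using strict_mono_id by blast
  next
    case (insert m A)
    then obtain r where r: "strict_mono r" "\<forall>m\<in>A. settles (\<lambda>j. \<zeta> (r j) $ m)" by blast
    have le1: "weight (\<zeta> (r j) $ m) \<le> 1" for j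
      using \<zeta>[of "r j"] member_le_sum[of m UNIV "\<lambda>m. weight (\<zeta> (r j) $ m)"] by (auto simp: Params_def)
    have "\<exists>r'. strict_mono r' \<and> settles (\<lambda>j. \<zeta> (r (r' j)) $ m)"
      by (rule settling_subsequence) (use \<zeta> le1 in \<open>auto simp: Params_def\<close>)
    then obtain r' where r': "strict_mono r'" "settles (\<lambda>j. \<zeta> (r (r' j)) $ m)" by blast
    have "settles (\<lambda>j. \<zeta> (r (r' j)) $ k)" if "k \<in> A" for k
      using settles_subseq[OF r(2)[rule_format, OF that] r'(1)] .
    with r' have "\<forall>k\<in>insert m A. settles (\<lambda>j. \<zeta> ((r \<circ> r') j) $ k)" by auto
    then show ?case using strict_mono_o[OF r(1) r'(1)] by blast
  qed
  from this[of UNIV] show ?thesis by simp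
qed

context loc_scale_families
begin

text \<open>If the mixture density does not depend on \<open>R\<close>, neither does the part contributed by the components
  outside \<open>S\<close>. This part is at most of order \<open>1 / R\<close>, hence it is 0 almost everywhere, while its
  integral is the sum of the weights.\<close>

lemma flat_weights_vanish:
  assumes P: "\<theta> \<in> Params"
    and eq: "\<And>R. 0 < R \<Longrightarrow> AE x in lborel. mixture \<phi> (flatten S R \<theta>) x = f x"
    and m: "m \<notin> S"
  shows "weight (\<theta> $ m) = 0"
proof -
  have w: "0 \<le> weight (\<theta> $ m)" for m using P by (simp add: Params_def)
  define e where "e R x = (\<Sum>m\<in>-S. weight (flatten S R \<theta> $ m) *
      loc_scale (\<phi> m) (location (flatten S R \<theta> $ m)) (scale (flatten S R \<theta> $ m)) x)" for R x
  have e_eq: "e R x = (\<Sum>m\<in>-S. weight (\<theta> $ m) * loc_scale (\<phi> m) 0 R x)" for R x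
    unfolding e_def by (intro sum.cong) (auto simp: flatten_nth)
  have split: "mixture \<phi> (flatten S R \<theta>) x =
      (\<Sum>m\<in>S. weight (\<theta> $ m) * loc_scale (\<phi> m) (location (\<theta> $ m)) (scale (\<theta> $ m)) x) + e R x" for R x
  proof -
    have "mixture \<phi> (flatten S R \<theta>) x = (\<Sum>m\<in>S. weight (flatten S R \<theta> $ m) *
        loc_scale (\<phi> m) (location (flatten S R \<theta> $ m)) (scale (flatten S R \<theta> $ m)) x) + e R x"
      unfolding mixture_def e_def Compl_eq_Diff_UNIV by (rule sum.subset_diff[OF subset_UNIV finite, THEN trans, OF add.commute])
    also have "(\<Sum>m\<in>S. weight (flatten S R \<theta> $ m) *
        loc_scale (\<phi> m) (location (flatten S R \<theta> $ m)) (scale (flatten S R \<theta> $ m)) x) =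
      (\<Sum>m\<in>S. weight (\<theta> $ m) * loc_scale (\<phi> m) (location (\<theta> $ m)) (scale (\<theta> $ m)) x)"
      by (intro sum.cong) (auto simp: flatten_nth)
    finally show ?thesis .
  qed
  have "AE x in lborel. \<forall>k. mixture \<phi> (flatten S (real (Suc k)) \<theta>) x = f x"
    by (subst AE_all_countable) (intro allI eq, simp)
  then have "AE x in lborel. ennreal (e 1 x) = 0"
  proof eventually_elim
    case (elim x)
    \<comment> \<open>the components in \<open>S\<close> contribute the same for all \<open>R\<close>\<close>
    have const: "e 1 x = e (real (Suc k)) x" for k
      using elim[rule_format, of 0] elim[rule_format, of k] split[of "real (Suc k)" x] split[of 1 x] by simp
    have le: "e 1 x \<le> (\<Sum>m\<in>-S. weight (\<theta> $ m) * (v\<^sub>0 / real (Suc k)))" for k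
    proof -
      have "e (real (Suc k)) x \<le> (\<Sum>m\<in>-S. weight (\<theta> $ m) * (v\<^sub>0 / real (Suc k)))"
        unfolding e_eq using w by (intro sum_mono mult_left_mono loc_scale_le_height) auto
      with const[of k] show ?thesis by simp
    qed
    have "(\<lambda>k. \<Sum>m\<in>-S. weight (\<theta> $ m) * (v\<^sub>0 / real (Suc k))) \<longlonglongrightarrow> (\<Sum>m\<in>-S. weight (\<theta> $ m) * 0)"
      by (intro tendsto_sum tendsto_mult_left LIMSEQ_Suc[OF lim_const_over_n])
    then have "e 1 x \<le> (\<Sum>m\<in>-S. weight (\<theta> $ m) * 0)"
      by (rule LIMSEQ_le_const) (use le in auto)
    then show ?case by (simp add: ennreal_neg)
  qed
  then have "(\<integral>\<^sup>+x. ennreal (e 1 x) \<partial>lborel) = (\<integral>\<^sup>+x. 0 \<partial>(lborel :: real measure))"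
    by (rule nn_integral_cong_AE)
  moreover have "(\<integral>\<^sup>+x. ennreal (e 1 x) \<partial>lborel) = ennreal (\<Sum>m\<in>-S. weight (flatten S 1 \<theta> $ m))"
    unfolding e_def by (rule nn_integral_weighted) (use w P in \<open>auto simp: flatten_nth\<close>)
  ultimately have "(\<Sum>m\<in>-S. weight (flatten S 1 \<theta> $ m)) \<le> 0" by (simp add: ennreal_eq_0_iff)
  then have "(\<Sum>m\<in>-S. weight (flatten S 1 \<theta> $ m)) = 0"
    using w by (intro antisym sum_nonneg) (auto simp: flatten_nth)
  then have "weight (flatten S 1 \<theta> $ m) = 0"
    using w m by (subst (asm) sum_nonneg_eq_0_iff) (auto simp: flatten_nth)
  then show ?thesis using m by (simp add: flatten_nth)
qed

text \<open>The deterministic part of the argument, for one outcome. The balls around the points of \<open>C\<close> cover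
  all parameters of wrong densities, and near such a point the sequence \<open>\<eta>\<close> does not come with the
  components outside \<open>S\<close> all escaping.\<close>

lemma tendsto_equiv_params:
  fixes \<eta> :: "nat \<Rightarrow> 'm param"
  assumes \<theta>\<^sub>0: "\<theta>\<^sub>0 \<in> Params" and \<eta>: "\<And>n. 1 \<le> n \<Longrightarrow> \<eta> n \<in> Params"
    and cover: "\<And>\<theta>. \<theta> \<in> Params \<Longrightarrow> \<not> (AE x in lborel. mixture \<phi> \<theta> x = mixture \<phi> \<theta>\<^sub>0 x) \<Longrightarrow>
        \<exists>\<theta>'\<in>C. dist \<theta> \<theta>' < \<rho> \<theta>'"
    and excluded: "\<And>\<theta>'. \<theta>' \<in> C \<Longrightarrow> \<forall>\<^sub>F n in sequentially. \<forall>S R. 0 < R \<longrightarrow>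
        dist (flatten S R (\<eta> n)) \<theta>' < \<rho> \<theta>' \<longrightarrow> (\<exists>m. m \<notin> S \<and> \<eta> n $ m \<in> moderate (K \<theta>'))"
  shows "(\<lambda>n. setdist (equiv_params \<phi> (\<eta> n)) (equiv_params \<phi> \<theta>\<^sub>0)) \<longlonglongrightarrow> 0"
proof (rule ccontr)
  let ?D = "\<lambda>n. setdist (equiv_params \<phi> (\<eta> n)) (equiv_params \<phi> \<theta>\<^sub>0)"
  assume "\<not> ?D \<longlonglongrightarrow> 0"
  then obtain e where e: "0 < e" "\<And>N. \<exists>n\<ge>N. e \<le> ?D n"
    unfolding lim_sequentially by (auto simp: not_less setdist_pos_le)
  have inf: "infinite {n. 1 \<le> n \<and> e \<le> ?D n}"
  proof -
    have "\<exists>n\<ge>N. 1 \<le> n \<and> e \<le> ?D n" for N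
      using e(2)[of "max 1 N"] by auto
    then show ?thesis by (auto simp: infinite_nat_iff_unbounded_le)
  qed
  define r\<^sub>0 where "r\<^sub>0 = enumerate {n. 1 \<le> n \<and> e \<le> ?D n}"
  have r\<^sub>0: "strict_mono r\<^sub>0" "\<And>j. 1 \<le> r\<^sub>0 j" "\<And>j. e \<le> ?D (r\<^sub>0 j)"
    using strict_mono_enumerate[OF inf] enumerate_in_set[OF inf] by (auto simp: r\<^sub>0_def)
  obtain r\<^sub>1 where r\<^sub>1: "strict_mono r\<^sub>1" "\<And>m. settles (\<lambda>j. \<eta> (r\<^sub>0 (r\<^sub>1 j)) $ m)"
    using settling_subsequence_all[of "\<lambda>j. \<eta> (r\<^sub>0 j)"] \<eta> r\<^sub>0(2) by blast
  define q where "q = r\<^sub>0 \<circ> r\<^sub>1"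
  have q: "strict_mono q" unfolding q_def by (rule strict_mono_o[OF r\<^sub>0(1) r\<^sub>1(1)])
  define \<zeta> where "\<zeta> j = \<eta> (q j)" for j
  have \<zeta>: "\<zeta> j \<in> Params" "e \<le> setdist (equiv_params \<phi> (\<zeta> j)) (equiv_params \<phi> \<theta>\<^sub>0)" for j
    using \<eta> r\<^sub>0 by (auto simp: \<zeta>_def q_def)
  have settles: "settles (\<lambda>j. \<zeta> j $ m)" for m
    using r\<^sub>1(2) by (simp add: \<zeta>_def q_def)
  define S where "S = {m. \<exists>\<tau>. 0 < scale \<tau> \<and> (\<lambda>j. \<zeta> j $ m) \<longlonglongrightarrow> \<tau>}"
  have "\<exists>t. (\<lambda>j. weight (\<zeta> j $ m)) \<longlonglongrightarrow> weight t \<and> 0 < scale t \<and> (m \<in> S \<longrightarrow> (\<lambda>j. \<zeta> j $ m) \<longlonglongrightarrow> t)" for m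
  proof (cases "m \<in> S")
    case True
    then obtain t where "0 < scale t" "(\<lambda>j. \<zeta> j $ m) \<longlonglongrightarrow> t" unfolding S_def by blast
    with tendsto_fst[OF this(2)] show ?thesis by blast
  next
    case False
    obtain a where "(\<lambda>j. weight (\<zeta> j $ m)) \<longlonglongrightarrow> a" using settles[of m] by (auto simp: settles_def)
    with False show ?thesis by (intro exI[of _ "(a, 0, 1)"]) auto
  qed
  then obtain \<tau> where \<tau>: "\<And>m. (\<lambda>j. weight (\<zeta> j $ m)) \<longlonglongrightarrow> weight (\<tau> m)" "\<And>m. 0 < scale (\<tau> m)"
      "\<And>m. m \<in> S \<Longrightarrow> (\<lambda>j. \<zeta> j $ m) \<longlonglongrightarrow> \<tau> m"
    by metis
  define \<theta> :: "'m param" where "\<theta> = (\<chi> m. \<tau> m)"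
  have escape: "\<forall>\<^sub>F j in sequentially. \<zeta> j $ m \<notin> moderate k" if "m \<notin> S" for m k
    using settles[of m] that by (auto simp: settles_def S_def)
  have \<theta>: "\<theta> \<in> Params"
  proof -
    have "0 \<le> weight (\<tau> m)" for m
      by (rule LIMSEQ_le_const[OF \<tau>(1)]) (use \<zeta>(1) in \<open>auto simp: Params_def\<close>)
    moreover have "(\<lambda>j. \<Sum>m\<in>UNIV. weight (\<zeta> j $ m)) \<longlonglongrightarrow> (\<Sum>m\<in>UNIV. weight (\<tau> m))"
      by (intro tendsto_sum \<tau>(1))
    then have "(\<lambda>j. 1) \<longlonglongrightarrow> (\<Sum>m\<in>UNIV. weight (\<tau> m))"
      using \<zeta>(1) by (simp add: Params_def)
    then have "(\<Sum>m\<in>UNIV. weight (\<tau> m)) = 1"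
      using LIMSEQ_unique[OF tendsto_const] by metis
    ultimately show ?thesis using \<tau>(2) by (simp add: Params_def \<theta>_def)
  qed
  have lim: "(\<lambda>j. flatten S R (\<zeta> j)) \<longlonglongrightarrow> flatten S R \<theta>" for R
  proof (rule vec_tendstoI)
    fix m
    show "(\<lambda>j. flatten S R (\<zeta> j) $ m) \<longlonglongrightarrow> flatten S R \<theta> $ m"
      using \<tau>(1,3)[of m] by (auto simp: flatten_nth \<theta>_def intro!: tendsto_Pair)
  qed
  have AE_eq: "AE x in lborel. mixture \<phi> (flatten S R \<theta>) x = mixture \<phi> \<theta>\<^sub>0 x" if R: "0 < R" for R
  proof (rule ccontr)
    assume "\<not> ?thesis"
    from cover[OF flatten_in_Params[OF \<theta> R] this]
    obtain \<theta>' where \<theta>': "\<theta>' \<in> C" "dist (flatten S R \<theta>) \<theta>' < \<rho> \<theta>'" by blast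
    have "\<forall>\<^sub>F j in sequentially. dist (flatten S R (\<zeta> j)) \<theta>' < \<rho> \<theta>'"
      by (rule order_tendstoD(2)[OF tendsto_dist[OF lim tendsto_const] \<theta>'(2)])
    moreover have "\<forall>\<^sub>F j in sequentially. \<forall>m\<in>-S. \<zeta> j $ m \<notin> moderate (K \<theta>')"
      using escape by (intro eventually_ball_finite) auto
    moreover have "\<forall>\<^sub>F j in sequentially. \<forall>S R. 0 < R \<longrightarrow>
        dist (flatten S R (\<zeta> j)) \<theta>' < \<rho> \<theta>' \<longrightarrow> (\<exists>m. m \<notin> S \<and> \<zeta> j $ m \<in> moderate (K \<theta>'))"
      using eventually_subseq[OF q excluded[OF \<theta>'(1)]] by (simp add: \<zeta>_def)
    ultimately have "\<forall>\<^sub>F j in sequentially. False"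
      by eventually_elim (use R in blast)
    then show False by simp
  qed
  have zero: "weight (\<tau> m) = 0" if "m \<notin> S" for m
    using flat_weights_vanish[OF \<theta> AE_eq that] by (simp add: \<theta>_def)
  \<comment> \<open>the escaping components keep their location and scale and lose only their weight\<close>
  define w :: "nat \<Rightarrow> 'm param" where "w j = (\<chi> m. if m \<in> S then \<tau> m else (0, snd (\<zeta> j $ m)))" for j
  have "e \<le> dist (\<zeta> j) (w j)" for j
  proof -
    have weq: "weight (w j $ m) = weight (\<tau> m)" for m using zero by (simp add: w_def)
    have "w j \<in> Params"
      using \<theta> \<zeta>(1)[of j] by (auto simp: Params_def weq \<theta>_def) (auto simp: w_def)
    moreover have "mixture \<phi> (w j) x = mixture \<phi> (flatten S 1 \<theta>) x" for x
      unfolding mixture_def using zero by (intro sum.cong) (auto simp: w_def flatten_nth \<theta>_def)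
    ultimately have "w j \<in> equiv_params \<phi> \<theta>\<^sub>0"
      using AE_eq[of 1] by (simp add: equiv_params_def)
    moreover have "\<zeta> j \<in> equiv_params \<phi> (\<zeta> j)" using \<zeta>(1) by (simp add: equiv_params_def)
    ultimately show ?thesis using \<zeta>(2)[of j] by (meson order_trans setdist_le_dist)
  qed
  moreover have "(\<lambda>j. \<zeta> j - w j) \<longlonglongrightarrow> 0"
  proof (rule vec_tendstoI)
    fix m
    show "(\<lambda>j. (\<zeta> j - w j) $ m) \<longlonglongrightarrow> 0 $ m"
    proof (cases "m \<in> S")
      case True
      then show ?thesis using tendsto_diff[OF \<tau>(3)[OF True] tendsto_const[of "\<tau> m"]] by (simp add: w_def)
    next
      case False
      have "\<zeta> j $ m - (0, snd (\<zeta> j $ m)) = (weight (\<zeta> j $ m), 0)" for j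
        by (simp add: prod_eq_iff)
      moreover have "(\<lambda>j. (weight (\<zeta> j $ m), 0 :: real \<times> real)) \<longlonglongrightarrow> (0, 0)"
        using \<tau>(1)[of m] zero[OF False] by (intro tendsto_Pair) auto
      ultimately show ?thesis using False by (simp add: w_def zero_prod_def)
    qed
  qed
  then have "(\<lambda>j. dist (\<zeta> j) (w j)) \<longlonglongrightarrow> 0"
    using tendsto_norm_zero by (simp add: dist_norm)
  ultimately have "e \<le> 0"
    by (intro LIMSEQ_le_const) auto
  with e(1) show False by simp
qed

end

section \<open>Consistency\<close>

context mixture_sieve
begin

lemma sieve_contains_true_param: "\<forall>\<^sub>F n in sequentially. \<theta>\<^sub>0 \<in> restricted_params (c n)"
proof -
  obtain s where s: "0 < s" "\<And>m. s \<le> scale (\<theta>\<^sub>0 $ m)"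
    using min_scale[OF true_param] by blast
  have "c \<longlonglongrightarrow> 0"
    unfolding scale_bound[abs_def] using rate by real_asymp
  from order_tendstoD(2)[OF this s(1)] show ?thesis
  proof eventually_elim
    case (elim n)
    have "c n \<le> scale (\<theta>\<^sub>0 $ m)" for m using elim s(2)[of m] by linarith
    then show ?case using true_param by (simp add: restricted_params_def)
  qed
qed

text \<open>Local domination has an exceptional null set for each wrong parameter. By Lindelof's
  theorem countably many of the corresponding balls cover all wrong parameters, so that their null
  sets can be united.\<close>

theorem restricted_mle_consistent:
  assumes mle: "AE \<omega> in P. \<forall>n\<ge>1. is_restricted_mle \<phi> (c n) n (\<lambda>i. X i \<omega>) (\<theta>hat n \<omega>)"
  shows "AE \<omega> in P. (\<lambda>n. setdist (equiv_params \<phi> (\<theta>hat n \<omega>)) (equiv_params \<phi> \<theta>\<^sub>0)) \<longlonglongrightarrow> 0"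
proof -
  define N where "N = {\<theta> \<in> Params. \<not> (AE x in lborel. mixture \<phi> \<theta> x = f\<^sub>0 x)}"
  define beaten where "beaten \<theta> \<rho> K \<omega> n \<longleftrightarrow> (\<forall>S R. \<forall>\<eta>\<in>restricted_params (c n).
    0 < R \<longrightarrow> dist (flatten S R \<eta>) \<theta> < \<rho> \<longrightarrow> (\<forall>m. m \<notin> S \<longrightarrow> \<eta> $ m \<notin> moderate K) \<longrightarrow>
    (\<Prod>i=1..n. mixture \<phi> \<eta> (X i \<omega>)) < (\<Prod>i=1..n. f\<^sub>0 (X i \<omega>)))" for \<theta> \<rho> K \<omega> n
  have "\<forall>\<theta>\<in>N. \<exists>\<rho> K. 0 < \<rho> \<and> (AE \<omega> in P. \<forall>\<^sub>F n in sequentially. beaten \<theta> \<rho> K \<omega> n)"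
    using local_domination unfolding N_def beaten_def by blast
  then obtain \<rho> K where \<rho>: "\<And>\<theta>. \<theta> \<in> N \<Longrightarrow> 0 < \<rho> \<theta>"
      "\<And>\<theta>. \<theta> \<in> N \<Longrightarrow> AE \<omega> in P. \<forall>\<^sub>F n in sequentially. beaten \<theta> (\<rho> \<theta>) (K \<theta>) \<omega> n"
    by metis
  obtain F' where F': "F' \<subseteq> (\<lambda>\<theta>. ball \<theta> (\<rho> \<theta>)) ` N" "countable F'" "\<Union>F' = (\<Union>\<theta>\<in>N. ball \<theta> (\<rho> \<theta>))"
    using Lindelof[of "(\<lambda>\<theta>. ball \<theta> (\<rho> \<theta>)) ` N"] by blast
  then obtain C where C: "countable C" "C \<subseteq> N" "F' = (\<lambda>\<theta>. ball \<theta> (\<rho> \<theta>)) ` C"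
    using countable_subset_image[of F' "\<lambda>\<theta>. ball \<theta> (\<rho> \<theta>)" N] by blast
  have cover: "\<exists>\<theta>'\<in>C. dist \<theta> \<theta>' < \<rho> \<theta>'"
    if "\<theta> \<in> Params" "\<not> (AE x in lborel. mixture \<phi> \<theta> x = f\<^sub>0 x)" for \<theta>
  proof -
    have \<theta>: "\<theta> \<in> N" using that by (simp add: N_def)
    then have "\<theta> \<in> ball \<theta> (\<rho> \<theta>)" using \<rho> by simp
    with \<theta> have "\<theta> \<in> \<Union>F'" using F'(3) by blast
    then show ?thesis using C(3) by (auto simp: dist_commute)
  qed
  have "AE \<omega> in P. \<forall>\<theta>\<in>C. \<forall>\<^sub>F n in sequentially. beaten \<theta> (\<rho> \<theta>) (K \<theta>) \<omega> n"
    unfolding AE_ball_countable[OF C(1)] using \<rho>(2) C(2) by blast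
  with mle show ?thesis
  proof eventually_elim
    case (elim \<omega>)
    show ?case
    proof (rule tendsto_equiv_params[OF true_param _ cover])
      show "\<theta>hat n \<omega> \<in> Params" if "1 \<le> n" for n
        using elim(1) that by (auto simp: is_restricted_mle_def is_arg_max_def restricted_params_def)
      fix \<theta>' assume "\<theta>' \<in> C"
      from elim(2)[rule_format, OF this] sieve_contains_true_param eventually_ge_at_top[of 1]
      show "\<forall>\<^sub>F n in sequentially. \<forall>S R. 0 < R \<longrightarrow> dist (flatten S R (\<theta>hat n \<omega>)) \<theta>' < \<rho> \<theta>' \<longrightarrow>
          (\<exists>m. m \<notin> S \<and> \<theta>hat n \<omega> $ m \<in> moderate (K \<theta>'))"
      proof eventually_elim
        case (elim n)
        have "is_restricted_mle \<phi> (c n) n (\<lambda>i. X i \<omega>) (\<theta>hat n \<omega>)"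
          using \<open>\<forall>n\<ge>1. is_restricted_mle \<phi> (c n) n (\<lambda>i. X i \<omega>) (\<theta>hat n \<omega>)\<close> elim(3) by blast
        then have "\<theta>hat n \<omega> \<in> restricted_params (c n)"
            "\<not> (\<Prod>i=1..n. mixture \<phi> (\<theta>hat n \<omega>) (X i \<omega>)) < (\<Prod>i=1..n. f\<^sub>0 (X i \<omega>))"
          using elim(2) by (auto simp: is_restricted_mle_def is_arg_max_def)
        with elim(1) show ?case unfolding beaten_def by blast
      qed
    qed
  qed
qed

end

theorem theorem2:
  fixes \<phi> :: "'m::finite \<Rightarrow> real \<Rightarrow> real"
    and \<theta>\<^sub>0 :: "'m param"
    and P :: "'w measure"
    and X :: "nat \<Rightarrow> 'w \<Rightarrow> real"
    and \<theta>hat :: "nat \<Rightarrow> 'w \<Rightarrow> 'm param"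
    and v\<^sub>0 v\<^sub>1 \<beta> c\<^sub>0 d :: real
    and c :: "nat \<Rightarrow> real"
  assumes densities: "\<And>m. prob_density (\<phi> m)"
    and true_param: "\<theta>\<^sub>0 \<in> Params"
    and prob: "prob_space P"
    and sample_indep: "prob_space.indep_vars P (\<lambda>_. borel) X {1..}"
    and sample_distr:
      "\<And>i. 1 \<le> i \<Longrightarrow> distributed P lborel (X i) (\<lambda>x. ennreal (mixture \<phi> \<theta>\<^sub>0 x))"
    and bounds_pos: "0 < v\<^sub>0" "0 < v\<^sub>1" "1 < \<beta>"
    and tail_bound: \<comment> \<open>at \<open>x = 0\<close> the bound \<open>v\<^sub>1 * \<bar>x\<bar> powr (-\<beta>)\<close> is meant to be infinite\<close>
      "\<And>m x. \<phi> m x \<le> v\<^sub>0 \<and> (x \<noteq> 0 \<longrightarrow> \<phi> m x \<le> v\<^sub>1 * \<bar>x\<bar> powr (-\<beta>))"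
    and sup_measurable:
      "\<And>\<Gamma> \<theta>. compact \<Gamma> \<Longrightarrow> \<Gamma> \<subseteq> Params \<Longrightarrow> \<theta> \<in> \<Gamma> \<Longrightarrow>
         \<forall>\<^sub>F \<rho> in at_right 0.
           (\<lambda>x. SUP \<theta>'\<in>{\<theta>'\<in>Params. dist \<theta>' \<theta> \<le> \<rho>}. ennreal (mixture \<phi> \<theta>' x))
             \<in> borel_measurable lebesgue"
    and ae_continuous:
      "\<And>\<Gamma> \<theta>. compact \<Gamma> \<Longrightarrow> \<Gamma> \<subseteq> Params \<Longrightarrow> \<theta> \<in> \<Gamma> \<Longrightarrow>
         AE x in lborel. \<forall>s. (\<forall>j. s j \<in> \<Gamma>) \<and> s \<longlonglongrightarrow> \<theta> \<longrightarrow>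
           (\<lambda>j. mixture \<phi> (s j) x) \<longlonglongrightarrow> mixture \<phi> \<theta> x"
    and entropy: "integrable lborel (\<lambda>x. \<bar>ln (mixture \<phi> \<theta>\<^sub>0 x)\<bar> * mixture \<phi> \<theta>\<^sub>0 x)"
    and exact_order: "mixture \<phi> \<theta>\<^sub>0 \<in> subdensities \<phi> CARD('m) - subdensities \<phi> (CARD('m) - 1)"
    and rate: "0 < c\<^sub>0" "0 < d" "d < 1"
    and scale_bound: "\<And>n. c n = c\<^sub>0 * exp (- (real n powr d))"
    and mle: "AE \<omega> in P. \<forall>n\<ge>1. is_restricted_mle \<phi> (c n) n (\<lambda>i. X i \<omega>) (\<theta>hat n \<omega>)"
  shows "AE \<omega> in P.
    (\<lambda>n. setdist (equiv_params \<phi> (\<theta>hat n \<omega>)) (equiv_params \<phi> \<theta>\<^sub>0)) \<longlonglongrightarrow> 0"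
proof -
  interpret prob_space P by (rule prob)
  interpret mixture_sieve \<phi> v\<^sub>0 v\<^sub>1 \<beta> P \<theta>\<^sub>0 X c\<^sub>0 d c
    by unfold_locales (fact assms)+
  show ?thesis by (rule restricted_mle_consistent[OF mle])
qed

end
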